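(* Let $G$ be a connected graph with no false-twin vertices. If $G$ has at least $13$ vertices, then $G$ has at least $7$ bicliques.
   Context: All graphs are finite, simple, undirected and connected. Two distinct vertices $u,w$ are false twins if their open neighborhoods coincide, $N(u)=N(w)$; a graph is false-twin-free if it has no such pair. A biclique of $G$ is a maximal (under inclusion of vertex sets) induced complete bipartite subgraph of $G$ with both sides nonempty. *)

theory Defs
  imports Main
begin

definition simple_graph :: "'a set \<Rightarrow> ('a \<Rightarrow> 'a \<Rightarrow> bool) \<Rightarrow> bool" where
  "simple_graph V E \<longleftrightarrow> finite V \<and> (\<forall>u v. E u v \<longrightarrow> E v u) \<and> (\<forall>v. \<not> E v v)
     \<and> (\<forall>u v. E u v \<longrightarrow> u \<in> V \<and> v \<in> V)"

definition connected_graph :: "'a set \<Rightarrow> ('a \<Rightarrow> 'a \<Rightarrow> bool) \<Rightarrow> bool" where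
  "connected_graph V E \<longleftrightarrow> V \<noteq> {} \<and> (\<forall>u\<in>V. \<forall>v\<in>V. E\<^sup>*\<^sup>* u v)"

definition nbhd :: "'a set \<Rightarrow> ('a \<Rightarrow> 'a \<Rightarrow> bool) \<Rightarrow> 'a \<Rightarrow> 'a set" where
  "nbhd V E v = {u \<in> V. E v u}"

definition false_twin_free :: "'a set \<Rightarrow> ('a \<Rightarrow> 'a \<Rightarrow> bool) \<Rightarrow> bool" where
  "false_twin_free V E \<longleftrightarrow> (\<forall>u\<in>V. \<forall>w\<in>V. u \<noteq> w \<longrightarrow> nbhd V E u \<noteq> nbhd V E w)"

definition induced_complete_bipartite :: "'a set \<Rightarrow> ('a \<Rightarrow> 'a \<Rightarrow> bool) \<Rightarrow> 'a set \<Rightarrow> bool" where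
  "induced_complete_bipartite V E S \<longleftrightarrow> S \<subseteq> V \<and>
     (\<exists>X Y. S = X \<union> Y \<and> X \<inter> Y = {} \<and> X \<noteq> {} \<and> Y \<noteq> {} \<and>
        (\<forall>x\<in>X. \<forall>x'\<in>X. \<not> E x x') \<and> (\<forall>y\<in>Y. \<forall>y'\<in>Y. \<not> E y y') \<and>
        (\<forall>x\<in>X. \<forall>y\<in>Y. E x y))"

text \<open>Bicliques, identified with their vertex sets (an induced subgraph is
  determined by its vertex set): maximal under inclusion.\<close>

definition bicliques :: "'a set \<Rightarrow> ('a \<Rightarrow> 'a \<Rightarrow> bool) \<Rightarrow> 'a set set" where
  "bicliques V E = {S. induced_complete_bipartite V E S \<and>
     (\<forall>T. induced_complete_bipartite V E T \<and> S \<subseteq> T \<longrightarrow> T = S)}"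

end

theory Submission
  imports Defs
begin

text \<open>
  Suppose there are at most six bicliques and at least 13 vertices.

  Every maximal independent subset of a neighbourhood is a side of a biclique, so there are at most
  twelve such sets. A vertex \<open>v\<close> in no triangle contributes \<open>N v\<close>; if the triangles are vertex
  disjoint, a vertex \<open>u\<close> of the triangle \<open>{u, t, s}\<close> contributes \<open>N u - {s}\<close> and \<open>N u - {t}\<close>. A set of
  the latter kind arises from at most two pairs (three of them would give seven bicliques on nine
  vertices), and whenever one of them coincides with some \<open>N v\<close>, the next one along the triangle
  arises only once. So there are at least as many sides as vertices.

  If two triangles meet, twin-freeness yields an induced \<open>K4\<close>, butterfly, gem or kite. If an induced
  subgraph \<open>H\<close> already has six bicliques, then each biclique of the graph extends exactly one of
  them, and a vertex is determined by its trace on \<open>H\<close>. The four graphs and their extensions by at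
  most two vertices reduce to this situation, where a computation finds at most twelve possible
  traces.
\<close>

section \<open>Complete bipartite induced subgraphs\<close>

locale finite_graph =
  fixes V :: "'a set" and E :: "'a \<Rightarrow> 'a \<Rightarrow> bool"
  assumes simple: "simple_graph V E"
begin

abbreviation cb :: "'a set \<Rightarrow> bool" where
  "cb \<equiv> induced_complete_bipartite V E"

lemma finite_V: "finite V"
  and sym: "E u v \<Longrightarrow> E v u"
  and irrefl: "\<not> E v v"
  and edge_in: "E u v \<Longrightarrow> u \<in> V" "E u v \<Longrightarrow> v \<in> V"
  using simple by (auto simp: simple_graph_def)

lemma adj_commute: "E u v \<longleftrightarrow> E v u"
  using sym by blast

definition bipartition :: "'a set \<Rightarrow> 'a set \<Rightarrow> bool" where
  "bipartition A B \<longleftrightarrow> (\<forall>a\<in>A. \<forall>a'\<in>A. \<not> E a a') \<and> (\<forall>b\<in>B. \<forall>b'\<in>B. \<not> E b b') \<and> (\<forall>a\<in>A. \<forall>b\<in>B. E a b)"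

lemma bipartition_commute: "bipartition A B \<longleftrightarrow> bipartition B A"
  unfolding bipartition_def using sym by blast

lemma bipartition_mono: "bipartition A B \<Longrightarrow> A' \<subseteq> A \<Longrightarrow> B' \<subseteq> B \<Longrightarrow> bipartition A' B'"
  unfolding bipartition_def by blast

lemma cb_bipartition: "bipartition A B \<Longrightarrow> A \<subseteq> V \<Longrightarrow> B \<subseteq> V \<Longrightarrow> A \<noteq> {} \<Longrightarrow> B \<noteq> {} \<Longrightarrow> cb (A \<union> B)"
  unfolding bipartition_def induced_complete_bipartite_def
  using irrefl by (intro conjI exI[of _ A] exI[of _ B]) auto

text \<open>This is a condition on triples: it passes to subsets that still contain an edge, and one
  bad triple refutes it. For the converse, the parts are the non-neighbours and the neighbours of
  one end of an edge.\<close>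

lemma cb_iff:
  "cb S \<longleftrightarrow> S \<subseteq> V \<and> (\<exists>x\<in>S. \<exists>y\<in>S. E x y) \<and>
     (\<forall>x\<in>S. \<forall>y\<in>S. \<forall>z\<in>S. E x y \<longrightarrow> (E z x \<longleftrightarrow> \<not> E z y))"
proof
  show "S \<subseteq> V \<and> (\<exists>x\<in>S. \<exists>y\<in>S. E x y) \<and>
     (\<forall>x\<in>S. \<forall>y\<in>S. \<forall>z\<in>S. E x y \<longrightarrow> (E z x \<longleftrightarrow> \<not> E z y))"
    if "cb S"
  proof -
    obtain X Y where S: "S \<subseteq> V" "S = X \<union> Y" and ne: "X \<inter> Y = {}" "X \<noteq> {}" "Y \<noteq> {}"
      and XY: "\<forall>x\<in>X. \<forall>x'\<in>X. \<not> E x x'" "\<forall>y\<in>Y. \<forall>y'\<in>Y. \<not> E y y'" "\<forall>x\<in>X. \<forall>y\<in>Y. E x y"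
      using \<open>cb S\<close> unfolding induced_complete_bipartite_def by metis
    have E_iff: "E a b \<longleftrightarrow> (a \<in> X \<longleftrightarrow> b \<in> Y)" if "a \<in> S" "b \<in> S" for a b
      using that S(2) ne(1) XY adj_commute[of a b] by (cases "a \<in> X"; cases "b \<in> X") auto
    have "\<exists>x\<in>S. \<exists>y\<in>S. E x y" using ne XY(3) S(2) by blast
    moreover have "E z x \<longleftrightarrow> \<not> E z y" if "x \<in> S" "y \<in> S" "z \<in> S" "E x y" for x y z
      using that E_iff[of x y] E_iff[of z x] E_iff[of z y] S(2) ne(1) by blast
    ultimately show ?thesis using S(1) by blast
  qed
next
  assume a: "S \<subseteq> V \<and> (\<exists>x\<in>S. \<exists>y\<in>S. E x y) \<and>
     (\<forall>x\<in>S. \<forall>y\<in>S. \<forall>z\<in>S. E x y \<longrightarrow> (E z x \<longleftrightarrow> \<not> E z y))"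
  then obtain x y where xy: "x \<in> S" "y \<in> S" "E x y" by blast
  have tri: "E c a \<longleftrightarrow> \<not> E c b" if "a \<in> S" "b \<in> S" "c \<in> S" "E a b" for a b c
    using a that by blast
  have "\<not> E b c" if "b \<in> S" "c \<in> S" "\<not> E b x" "\<not> E c x" for b c
    using that tri[of x y b] tri[of x y c] tri[of b c y] xy adj_commute by metis
  moreover have "\<not> E b c" if "b \<in> S" "c \<in> S" "E b x" "E c x" for b c
    using that tri[of b c x] xy adj_commute by metis
  moreover have "E b c" if "b \<in> S" "c \<in> S" "\<not> E b x" "E c x" for b c
    using that tri[of c x b] xy by blast
  ultimately have "bipartition {z\<in>S. \<not> E z x} {z\<in>S. E z x}" unfolding bipartition_def by simp
  then have "cb ({z\<in>S. \<not> E z x} \<union> {z\<in>S. E z x})"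
  proof (rule cb_bipartition)
    show "{z\<in>S. \<not> E z x} \<subseteq> V" "{z\<in>S. E z x} \<subseteq> V" using a by blast+
    show "{z\<in>S. \<not> E z x} \<noteq> {}" using xy(1) irrefl by blast
    show "{z\<in>S. E z x} \<noteq> {}" using xy sym by blast
  qed
  moreover have "{z\<in>S. \<not> E z x} \<union> {z\<in>S. E z x} = S" by blast
  ultimately show "cb S" by simp
qed

lemma cb_mono:
  assumes "cb C" "C \<subseteq> S" "S \<subseteq> T" "cb T"
  shows "cb S"
proof -
  have "\<exists>x\<in>S. \<exists>y\<in>S. E x y" using assms(1,2) unfolding cb_iff by blast
  moreover have "E z x \<longleftrightarrow> \<not> E z y" if "x \<in> S" "y \<in> S" "z \<in> S" "E x y" for x y z
    using assms(3,4) that unfolding cb_iff by blast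
  moreover have "S \<subseteq> V" using assms(3,4) unfolding cb_iff by blast
  ultimately show ?thesis unfolding cb_iff by blast
qed

lemma not_cbI: "x \<in> S \<Longrightarrow> y \<in> S \<Longrightarrow> z \<in> S \<Longrightarrow> E x y \<Longrightarrow> E z x \<longleftrightarrow> E z y \<Longrightarrow> \<not> cb S"
  unfolding cb_iff by blast

text \<open>Recovers the bipartition from any vertex of \<open>T\<close>, with no appeal to a chosen
  witness in the definition.\<close>

lemma cb_split:
  assumes "cb T" "v \<in> T"
  shows "bipartition {z\<in>T. \<not> E v z} {z\<in>T. E v z}" "\<exists>z\<in>T. E v z"
proof -
  obtain x y where "x \<in> T" "y \<in> T" "E x y" using assms(1) unfolding cb_iff by blast
  then show ex: "\<exists>z\<in>T. E v z" using assms unfolding cb_iff by blast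
  have tri: "E c a \<longleftrightarrow> \<not> E c b" if "a \<in> T" "b \<in> T" "c \<in> T" "E a b" for a b c
    using assms(1) that unfolding cb_iff by blast
  obtain y where y: "y \<in> T" "E v y" using ex by blast
  have "\<not> E b c" if "b \<in> T" "c \<in> T" "\<not> E v b" "\<not> E v c" for b c
    using that tri[of v y b] tri[of v y c] tri[of b c y] assms(2) y adj_commute by metis
  moreover have "\<not> E b c" if "b \<in> T" "c \<in> T" "E v b" "E v c" for b c
    using that tri[of b c v] assms(2) by blast
  moreover have "E b c" if "b \<in> T" "c \<in> T" "\<not> E v b" "E v c" for b c
    using that tri[of v c b] assms(2) adj_commute by metis
  ultimately show "bipartition {z\<in>T. \<not> E v z} {z\<in>T. E v z}" unfolding bipartition_def by simp
qed

section \<open>Lower bounds on the number of bicliques\<close>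

lemma finite_bicliques: "finite (bicliques V E)"
  by (rule finite_subset[of _ "Pow V"])
    (auto simp: bicliques_def induced_complete_bipartite_def finite_V)

lemma cb_extend:
  assumes "cb C"
  obtains B where "B \<in> bicliques V E" "C \<subseteq> B"
proof -
  have "{D. cb D} \<subseteq> Pow V" by (auto simp: cb_iff)
  then have "finite {D. cb D}" using finite_V by (auto intro: finite_subset)
  from finite_has_maximal2[OF this, of C] assms
  obtain B where "B \<in> {D. cb D}" "C \<subseteq> B" "\<forall>D\<in>{D. cb D}. B \<subseteq> D \<longrightarrow> B = D" by auto
  then have "B \<in> bicliques V E" unfolding bicliques_def by blast
  then show ?thesis using that \<open>C \<subseteq> B\<close> by blast
qed

text \<open>An analogue of the fooling sets of communication complexity: the members are pairwise
  incompatible, that is, no two of them fit into one biclique.\<close>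

definition fooling :: "'a set set \<Rightarrow> bool" where
  "fooling F \<longleftrightarrow> (\<forall>C\<in>F. cb C) \<and> (\<forall>C\<in>F. \<forall>D\<in>F. C \<noteq> D \<longrightarrow> \<not> cb (C \<union> D))"

text \<open>Extending each member to a biclique is injective: if two members had the same extension,
  \<open>cb_mono\<close> would make their union complete bipartite.\<close>

lemma card_fooling:
  assumes "fooling F"
  shows "card F \<le> card (bicliques V E)"
proof -
  have "\<exists>B. B \<in> bicliques V E \<and> C \<subseteq> B" if "C \<in> F" for C
    using cb_extend that assms unfolding fooling_def by metis
  then obtain ext where ext: "\<And>C. C \<in> F \<Longrightarrow> ext C \<in> bicliques V E \<and> C \<subseteq> ext C" by metis
  have "inj_on ext F"
  proof (rule inj_onI, rule ccontr)
    fix C D assume CD: "C \<in> F" "D \<in> F" "ext C = ext D" "C \<noteq> D"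
    then have "cb C" "cb (ext C)" "C \<union> D \<subseteq> ext C"
      using ext[of C] ext[of D] assms by (auto simp: fooling_def bicliques_def)
    then have "cb (C \<union> D)" using cb_mono[of C "C \<union> D" "ext C"] by simp
    then show False using CD assms by (auto simp: fooling_def)
  qed
  moreover have "ext ` F \<subseteq> bicliques V E" using ext by blast
  ultimately show ?thesis using card_inj_on_le finite_bicliques by blast
qed

lemma fooling_insert:
  assumes "fooling F" "cb D" "\<And>C. C \<in> F \<Longrightarrow> \<not> cb (C \<union> D)"
  shows "fooling (insert D F)"
  unfolding fooling_def
proof (intro conjI ballI impI)
  show "cb C" if "C \<in> insert D F" for C using that assms unfolding fooling_def by blast
  show "\<not> cb (C \<union> C')" if CC: "C \<in> insert D F" "C' \<in> insert D F" "C \<noteq> C'" for C C'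
  proof -
    consider "C = D" "C' \<in> F" | "C' = D" "C \<in> F" | "C \<in> F" "C' \<in> F" using CC by blast
    then show ?thesis
    proof cases
      case 1
      then show ?thesis using assms(3)[of C'] by (simp add: Un_commute)
    next
      case 2
      then show ?thesis using assms(3)[of C] by simp
    next
      case 3
      then show ?thesis using assms(1) CC(3) unfolding fooling_def by blast
    qed
  qed
qed

text \<open>A family as large as the number of bicliques cannot be enlarged, so \<open>D\<close>
  must be compatible with some member.\<close>

lemma fooling_hits:
  assumes F: "fooling F" "finite F" "card (bicliques V E) \<le> card F" and D: "cb D"
  obtains C where "C \<in> F" "cb (C \<union> D)"
proof (rule ccontr)
  assume "\<not> thesis"
  then have no: "\<not> cb (C \<union> D)" if "C \<in> F" for C using that \<open>\<And>C. C \<in> F \<Longrightarrow> cb (C \<union> D) \<Longrightarrow> thesis\<close> by blast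
  have "fooling (insert D F)" using fooling_insert F(1) D no by blast
  then have "card (insert D F) \<le> card F" using card_fooling F(3) by fastforce
  moreover have "D \<notin> F" using no[of D] D by (metis Un_absorb)
  ultimately show False using F(2) by simp
qed

text \<open>Otherwise replacing \<open>C\<close> by the two distinct bicliques above it gives a
  fooling family with one more member than there are bicliques.\<close>

lemma fooling_unique_biclique:
  assumes F: "fooling F" "finite F" "card (bicliques V E) \<le> card F"
    and C: "C \<in> F" and B: "B \<in> bicliques V E" "B' \<in> bicliques V E" "C \<subseteq> B" "C \<subseteq> B'"
  shows "B = B'"
proof (rule ccontr)
  assume neq: "B \<noteq> B'"
  have cbs: "cb B" "cb B'" "cb C" using B C F(1) by (auto simp: bicliques_def fooling_def)
  have BB: "\<not> cb (B \<union> B')" 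
  proof
    assume "cb (B \<union> B')"
    then have "B \<union> B' = B" "B \<union> B' = B'" using B(1,2) unfolding bicliques_def by blast+
    then show False using neq by blast
  qed
  have other: "\<not> cb (S \<union> D)" if "D \<in> F - {C}" "C \<subseteq> S" for S D
  proof
    assume "cb (S \<union> D)"
    then have "cb (C \<union> D)" using cb_mono[of C "C \<union> D" "S \<union> D"] cbs(3) that(2) by blast
    then show False using F(1) C that unfolding fooling_def by blast
  qed
  have "fooling (F - {C})" using F(1) unfolding fooling_def by blast
  moreover have "\<not> cb (D \<union> B')" if "D \<in> F - {C}" for D
    using other[OF that B(4)] by (simp add: Un_commute)
  ultimately have "fooling (insert B' (F - {C}))" using fooling_insert cbs(2) by blast
  moreover have "\<not> cb (D \<union> B)" if "D \<in> insert B' (F - {C})" for D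
  proof (cases "D = B'")
    case True
    then show ?thesis using BB by (simp add: Un_commute)
  next
    case False
    then show ?thesis using other[of D B] that B(3) by (simp add: Un_commute)
  qed
  ultimately have "fooling (insert B (insert B' (F - {C})))" using fooling_insert cbs(1) by blast
  then have le: "card (insert B (insert B' (F - {C}))) \<le> card F" using card_fooling F(3) by fastforce
  have "B \<notin> F - {C}" using other[of B B] B(3) cbs(1) by (metis Un_absorb)
  moreover have "B' \<notin> F - {C}" using other[of B' B'] B(4) cbs(2) by (metis Un_absorb)
  ultimately have "card (insert B (insert B' (F - {C}))) = Suc (Suc (card (F - {C})))"
    using F(2) neq by (subst card_insert_disjoint) auto
  also have "card F = Suc (card (F - {C}))" using C F(2) by (metis card_Suc_Diff1)
  then have "Suc (Suc (card (F - {C}))) = Suc (card F)" by (rule arg_cong[OF HOL.sym])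
  finally have "Suc (card F) \<le> card F" using le by (rule subst)
  then show False by (rule Suc_n_not_le_n[THEN notE])
qed

text \<open>For concrete families: only pairs in list order have to be checked, and distinctness of
  the members comes for free.\<close>

lemma length_fooling_list:
  assumes "\<And>C. C \<in> set Cs \<Longrightarrow> cb C" "sorted_wrt (\<lambda>C D. \<not> cb (C \<union> D)) Cs"
  shows "length Cs \<le> card (bicliques V E)"
proof -
  have pair: "\<not> cb (Cs ! i \<union> Cs ! j)" if "i < length Cs" "j < length Cs" "i \<noteq> j" for i j
  proof (cases "i < j")
    case True
    then show ?thesis using assms(2) that by (simp add: sorted_wrt_iff_nth_less)
  next
    case False
    then show ?thesis using assms(2) that Un_commute[of "Cs ! i"] by (simp add: sorted_wrt_iff_nth_less)
  qed
  have "distinct Cs"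
    unfolding distinct_conv_nth
  proof (intro allI impI)
    fix i j assume "i < length Cs" "j < length Cs" "i \<noteq> j"
    then show "Cs ! i \<noteq> Cs ! j" using pair[of i j] assms(1)[of "Cs ! i"] by auto
  qed
  moreover have "fooling (set Cs)"
    unfolding fooling_def
  proof (intro conjI ballI impI)
    show "cb C" if "C \<in> set Cs" for C by (rule assms(1)[OF that])
    fix C D assume "C \<in> set Cs" "D \<in> set Cs" "C \<noteq> D"
    then show "\<not> cb (C \<union> D)" using pair unfolding in_set_conv_nth by metis
  qed
  ultimately show ?thesis using card_fooling[of "set Cs"] by (simp add: distinct_card)
qed

end

section \<open>Graphs whose triangles are vertex disjoint\<close>

locale twin_free_graph = finite_graph +
  assumes twin_free: "false_twin_free V E"
    and no_isolated: "v \<in> V \<Longrightarrow> \<exists>w. E v w"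
begin

definition N :: "'a \<Rightarrow> 'a set" where "N v = {w. E v w}"

lemma N_iff [simp]: "w \<in> N v \<longleftrightarrow> E v w" by (simp add: N_def)

lemma N_subset: "N v \<subseteq> V" using edge_in by auto

lemma inj_N: "inj_on N V"
proof (rule inj_onI, rule ccontr)
  fix u v assume "u \<in> V" "v \<in> V" "N u = N v" "u \<noteq> v"
  moreover have "nbhd V E x = N x" for x using edge_in by (auto simp: nbhd_def)
  ultimately show False using twin_free unfolding false_twin_free_def by metis
qed

lemma distinguish:
  assumes "u \<in> V" "v \<in> V" "u \<noteq> v"
  obtains w where "E u w \<noteq> E v w"
proof (rule ccontr)
  assume "\<not> thesis"
  then have "E u w = E v w" for w using that by blast
  then have "N u = N v" by auto
  then show False using inj_onD[OF inj_N] assms by blast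
qed

text \<open>\<open>B \<inter> N u\<close> is the side of \<open>B\<close> opposite to
  \<open>u\<close>.\<close>

definition side :: "'a set \<Rightarrow> bool" where
  "side Y \<longleftrightarrow> (\<exists>B\<in>bicliques V E. \<exists>u\<in>B. Y = B \<inter> N u)"

text \<open>Fix an edge \<open>x\<close>-\<open>y\<close> of a biclique. Each of its vertices lies
  on the side of \<open>x\<close> or on that of \<open>y\<close>, so only two sets arise from
  it.\<close>

lemma card_sides: "card {Y. side Y} \<le> 2 * card (bicliques V E)" "finite {Y. side Y}"
proof -
  have two: "finite ((\<lambda>u. B \<inter> N u) ` B) \<and> card ((\<lambda>u. B \<inter> N u) ` B) \<le> 2" if "B \<in> bicliques V E" for B
  proof -
    have cbB: "cb B" using that by (simp add: bicliques_def)
    then obtain x y where xy: "x \<in> B" "y \<in> B" "E x y" unfolding cb_iff by blast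
    have dich: "E z u \<longleftrightarrow> \<not> E z w" if "u \<in> B" "w \<in> B" "z \<in> B" "E u w" for u w z
      using cbB that unfolding cb_iff by blast
    have "B \<inter> N u = B \<inter> N x \<or> B \<inter> N u = B \<inter> N y" if "u \<in> B" for u
    proof (cases "E u x")
      case True
      then have "E z u \<longleftrightarrow> E z y" if "z \<in> B" for z
        using dich[of u x z] dich[of x y z] that \<open>u \<in> B\<close> xy by blast
      then have "B \<inter> N u = B \<inter> N y" using adj_commute by auto
      then show ?thesis ..
    next
      case False
      then have "E u y" using dich that xy by blast
      then have "E z u \<longleftrightarrow> E z x" if "z \<in> B" for z
        using dich[of u y z] dich[of x y z] that \<open>u \<in> B\<close> xy by blast
      then have "B \<inter> N u = B \<inter> N x" using adj_commute by auto
      then show ?thesis ..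
    qed
    then have "(\<lambda>u. B \<inter> N u) ` B \<subseteq> {B \<inter> N x, B \<inter> N y}" by auto
    moreover have "card {B \<inter> N x, B \<inter> N y} \<le> 2" by (simp add: card_insert_if)
    ultimately show ?thesis by (meson card_mono finite.emptyI finite.insertI finite_subset order_trans)
  qed
  have eq: "{Y. side Y} = (\<Union>B\<in>bicliques V E. (\<lambda>u. B \<inter> N u) ` B)" by (auto simp: side_def)
  show "finite {Y. side Y}" unfolding eq using two finite_bicliques by blast
  have "card {Y. side Y} \<le> (\<Sum>B\<in>bicliques V E. card ((\<lambda>u. B \<inter> N u) ` B))"
    unfolding eq by (rule card_UN_le[OF finite_bicliques])
  also have "\<dots> \<le> (\<Sum>B\<in>bicliques V E. 2)" by (rule sum_mono) (use two in blast)
  finally show "card {Y. side Y} \<le> 2 * card (bicliques V E)" by simp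
qed

text \<open>The star formed by \<open>u\<close> and \<open>Y\<close> extends to a biclique
  \<open>B\<close>. The side \<open>B \<inter> N u\<close> is independent and contains
  \<open>Y\<close>, so by maximality it is \<open>Y\<close>.\<close>

lemma sideI:
  assumes "Y \<subseteq> N u" "Y \<noteq> {}" and ind: "\<And>y y'. y \<in> Y \<Longrightarrow> y' \<in> Y \<Longrightarrow> \<not> E y y'"
    and max: "\<And>z. z \<in> N u \<Longrightarrow> z \<notin> Y \<Longrightarrow> \<exists>y\<in>Y. E z y"
  shows "side Y"
proof -
  obtain y where "y \<in> Y" using assms(2) by blast
  then have "u \<in> V" using assms(1) edge_in(1)[of u y] by auto
  moreover have "bipartition {u} Y" unfolding bipartition_def using assms(1) ind irrefl by auto
  moreover have "Y \<subseteq> V" using assms(1) N_subset by blast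
  ultimately have "cb ({u} \<union> Y)" using cb_bipartition assms(2) by blast
  then obtain B where B: "B \<in> bicliques V E" "{u} \<union> Y \<subseteq> B" by (rule cb_extend)
  then have "cb B" by (simp add: bicliques_def)
  moreover have uB: "u \<in> B" using B(2) by simp
  ultimately have "bipartition {z\<in>B. \<not> E u z} {z\<in>B. E u z}" by (rule cb_split(1))
  then have ind_B: "\<forall>z\<in>{z\<in>B. E u z}. \<forall>z'\<in>{z\<in>B. E u z}. \<not> E z z'"
    unfolding bipartition_def by (elim conjE)
  have "z \<in> Y" if z: "z \<in> B" "E u z" for z
  proof (rule ccontr)
    assume "z \<notin> Y"
    then obtain y where y: "y \<in> Y" "E z y" using max[of z] z(2) by auto
    have "y \<in> B" "E u y" using y assms(1) B(2) by auto
    then show False using y ind_B z by blast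
  qed
  then have "B \<inter> N u \<subseteq> Y" by auto
  then have "Y = B \<inter> N u" using B(2) assms(1) by blast
  then show ?thesis using B(1) uB by (auto simp: side_def)
qed

end

lemma card_le_2I:
  assumes "\<And>a b c. a \<in> A \<Longrightarrow> b \<in> A \<Longrightarrow> c \<in> A \<Longrightarrow> a = b \<or> b = c \<or> a = c"
  shows "card A \<le> 2"
proof (rule ccontr)
  assume "\<not> card A \<le> 2"
  then have "3 \<le> card A" by simp
  then obtain B where "B \<subseteq> A" "card B = 3" by (metis obtain_subset_with_card_n)
  then show False using assms unfolding card_3_iff by (metis insertI1 insert_commute subsetD)
qed

lemma card_le_fibres:
  assumes "finite A" "\<And>y. card {x \<in> A. f x = y} \<le> k"
  shows "card A \<le> k * card (f ` A)"
proof -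
  have "A = (\<Union>y\<in>f ` A. {x \<in> A. f x = y})" by auto
  then have "card A \<le> (\<Sum>y\<in>f ` A. card {x \<in> A. f x = y})"
    using card_UN_le[of "f ` A" "\<lambda>y. {x \<in> A. f x = y}"] assms(1) by simp
  also have "\<dots> \<le> (\<Sum>y\<in>f ` A. k)" by (rule sum_mono) (rule assms(2))
  finally show ?thesis by (simp add: mult.commute)
qed

section \<open>Triangles and the sides they contribute\<close>

locale disjoint_triangles = twin_free_graph +
  assumes edge_triangle: "E x y \<Longrightarrow> E x p \<Longrightarrow> E y p \<Longrightarrow> E x q \<Longrightarrow> E y q \<Longrightarrow> p = q"
    and vertex_triangle: "E u s \<Longrightarrow> E u t \<Longrightarrow> E s t \<Longrightarrow> E u s' \<Longrightarrow> E u t' \<Longrightarrow> E s' t' \<Longrightarrow> {s', t'} = {s, t}"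
    and few_bicliques: "card (bicliques V E) \<le> 6"
begin

definition tri :: "'a \<Rightarrow> 'a \<Rightarrow> 'a \<Rightarrow> bool" where
  "tri u t s \<longleftrightarrow> E u t \<and> E t s \<and> E s u"

lemma triD: "tri u t s \<Longrightarrow> E u t" "tri u t s \<Longrightarrow> E t s" "tri u t s \<Longrightarrow> E s u"
  "tri u t s \<Longrightarrow> E t u" "tri u t s \<Longrightarrow> E s t" "tri u t s \<Longrightarrow> E u s"
  using sym by (auto simp: tri_def)

lemma tri_rotate: "tri u t s \<Longrightarrow> tri t s u"
  by (auto simp: tri_def)

lemma tri_swap: "tri u t s \<Longrightarrow> tri u s t"
  using sym by (auto simp: tri_def)

text \<open>The triples are ordered, so that a triangle vertex \<open>u\<close> is represented once
  for each of the sets \<open>N u - {s}\<close> and \<open>N u - {t}\<close>.\<close>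

definition P :: "('a \<times> 'a \<times> 'a) set" where "P = {(u, t, s). tri u t s}"

definition I :: "'a set" where "I = {v \<in> V. \<forall>t s. \<not> tri v t s}"

lemma no_triangle_at_I: "v \<in> I \<Longrightarrow> E v x \<Longrightarrow> E v y \<Longrightarrow> \<not> E x y"
  using sym by (auto simp: I_def tri_def)

lemma finite_P: "finite P"
  by (rule finite_subset[of _ "V \<times> V \<times> V"]) (use finite_V edge_in in \<open>auto simp: P_def tri_def\<close>)

lemma node_eq_unique:
  assumes "tri u t s" "tri u t' s'" "N u - {s} = N u - {s'}"
  shows "t = t' \<and> s = s'"
proof -
  have "s \<in> N u" "s' \<in> N u" using triD assms(1,2) by auto
  then have "s = s'" using assms(3) by blast
  then show ?thesis using edge_triangle[of u s t t'] assms(1,2) triD by blast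
qed

text \<open>Otherwise \<open>v\<close> and \<open>s\<close> both lie in \<open>N x\<close>. Then
  \<open>x\<close> lies in \<open>N v\<close>, hence in \<open>N u\<close>, and \<open>x\<close>,
  \<open>u\<close>, \<open>s\<close> form a triangle at \<open>x\<close>.\<close>

lemma loop_next_free:
  assumes "tri u t s" "v \<in> I" "N u - {s} = N v" "x \<in> I"
  shows "N t - {u} \<noteq> N x"
proof
  assume eq: "N t - {u} = N x"
  have "t \<in> N u - {s}" using assms(1) triD irrefl by fastforce
  then have "E v t" using assms(3) by auto
  moreover have "v \<noteq> u" using assms(1,2) by (auto simp: I_def)
  ultimately have "v \<in> N t - {u}" using sym by auto
  then have "E x v" using eq by auto
  then have "x \<in> N u - {s}" using assms(3) sym by auto
  then have "E x u" using sym by auto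
  moreover have "s \<in> N t - {u}" using assms(1) triD irrefl by fastforce
  then have "E x s" using eq by auto
  ultimately show False using no_triangle_at_I[OF assms(4)] triD(6)[OF assms(1)] by blast
qed

text \<open>As \<open>v\<close> is adjacent to \<open>t\<close>, it lies in the common set. So
  \<open>u'\<close> lies in \<open>N v\<close>, hence in \<open>N u\<close>, and it is adjacent to
  \<open>s\<close>; the edge \<open>u\<close>-\<open>s\<close> then forces
  \<open>u' = t\<close>.\<close>

lemma loop_next_unshared:
  assumes "tri u t s" "v \<in> I" "N u - {s} = N v" "tri u' t' s'" "N t - {u} = N u' - {s'}"
  shows "u' = t \<and> t' = s \<and> s' = u"
proof -
  have "t \<in> N u - {s}" using assms(1) triD irrefl by fastforce
  then have "E v t" using assms(3) by auto
  moreover have "v \<noteq> u" using assms(1,2) by (auto simp: I_def)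
  ultimately have "v \<in> N t - {u}" using sym by auto
  then have "v \<in> N u' - {s'}" using assms(5) by simp
  then have "E v u'" using sym by auto
  then have "u' \<in> N u - {s}" using assms(3) by auto
  moreover have "s \<in> N t - {u}" using assms(1) triD irrefl by fastforce
  then have "s \<in> N u' - {s'}" using assms(5) by simp
  ultimately have "E u u'" "E s u'" using sym by auto
  then have u': "u' = t" using edge_triangle[of u s u' t] triD[OF assms(1)] by blast
  then have "N t - {u} = N t - {s'}" using assms(5) by simp
  moreover have "tri t s u" using assms(1) by (rule tri_rotate)
  ultimately show ?thesis using node_eq_unique[of t s u t' s'] assms(4) u' by blast
qed

text \<open>If \<open>t1 = t2\<close>, then \<open>u1\<close> and \<open>u2\<close> are the other
  two vertices of a single triangle. The vertex \<open>t3\<close> lies in \<open>Y\<close> and would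
  complete a second triangle on the edge \<open>u1\<close>-\<open>u2\<close>, unless
  \<open>t3 = t1\<close>, and then \<open>u3\<close> is one of \<open>u1\<close> and
  \<open>u2\<close>.\<close>

lemma shared_distinct:
  assumes "tri u1 t1 s1" "tri u2 t2 s2" "tri u3 t3 s3"
    and "N u1 - {s1} = Y" "N u2 - {s2} = Y" "N u3 - {s3} = Y"
    and "u1 \<noteq> u2" "u1 \<noteq> u3" "u2 \<noteq> u3"
  shows "t1 \<noteq> t2"
proof
  assume t: "t1 = t2"
  have "{u2, s2} = {u1, s1}"
    using vertex_triangle[of t1 u1 s1 u2 s2] triD[OF assms(1)] triD[OF assms(2)] t by blast
  then have u2: "u2 = s1" using assms(7) by auto
  show False
  proof (cases "t3 = t1")
    case True
    then have "{u3, s3} = {u1, s1}"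
      using vertex_triangle[of t1 u1 s1 u3 s3] triD[OF assms(1)] triD[OF assms(3)] by blast
    then show False using assms(8,9) u2 by auto
  next
    case False
    have "t3 \<in> N u3 - {s3}" using triD(1,5)[OF assms(3)] irrefl by auto
    then have "t3 \<in> N u1 - {s1}" "t3 \<in> N u2 - {s2}" using assms(4-6) by auto
    then have "E u1 t3" "E u2 t3" by auto
    then show False
      using edge_triangle[of u1 s1 t3 t1] triD[OF assms(1)] u2 False by blast
  qed
qed

text \<open>The picture is a \<open>K_{3,3}\<close> with a vertex \<open>s_i\<close> attached to
  each edge \<open>u_i\<close>-\<open>t_i\<close> of a perfect matching. The \<open>K_{3,3}\<close>
  and the six stars centred at \<open>u_i\<close> and \<open>t_i\<close> are pairwise
  incompatible.\<close>

lemma seven_bicliques: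
  assumes tri: "tri u1 t1 s1" "tri u2 t2 s2" "tri u3 t3 s3"
    and u: "u1 \<noteq> u2" "u1 \<noteq> u3" "u2 \<noteq> u3" and t: "t1 \<noteq> t2" "t1 \<noteq> t3" "t2 \<noteq> t3"
    and ut: "E u1 t2" "E u1 t3" "E u2 t1" "E u2 t3" "E u3 t1" "E u3 t2"
  shows False
proof -
  \<comment> \<open>Each of the nonadjacencies holds because otherwise some edge would lie in two
    triangles.\<close>
  have uu: "\<not> E u u'" if "E u t" "E u t'" "E u' t" "E u' t'" "t \<noteq> t'" for u u' t t'
    using edge_triangle[of u u' t t'] that by blast
  have tt: "\<not> E t t'" if "E u t" "E u t'" "E u' t" "E u' t'" "u \<noteq> u'" for u u' t t'
    using edge_triangle[of t t' u u'] that sym by blast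
  have su: "\<not> E s u'" if "tri u t s" "E u' t" "u \<noteq> u'" for u t s u'
    using edge_triangle[of s t u u'] that triD sym by blast
  have st: "\<not> E s t'" if "tri u t s" "E u t'" "t \<noteq> t'" for u t s t'
    using edge_triangle[of u s t t'] that triD by blast
  note e = triD(1,2,3)[OF tri(1)] triD(1,2,3)[OF tri(2)] triD(1,2,3)[OF tri(3)]
  have n: "\<not> E u1 u2" "\<not> E u1 u3" "\<not> E u2 u3" "\<not> E t1 t2" "\<not> E t1 t3" "\<not> E t2 t3"
    using uu[of u1 t1 t2 u2] uu[of u1 t1 t3 u3] uu[of u2 t2 t3 u3]
      tt[of u1 t1 t2 u2] tt[of u1 t1 t3 u3] tt[of u2 t2 t3 u3] e ut u t by blast+
  have ns: "\<not> E s1 u2" "\<not> E s1 u3" "\<not> E s2 u1" "\<not> E s2 u3" "\<not> E s3 u1" "\<not> E s3 u2"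
    "\<not> E s1 t2" "\<not> E s1 t3" "\<not> E s2 t1" "\<not> E s2 t3" "\<not> E s3 t1" "\<not> E s3 t2"
    using su[OF tri(1), of u2] su[OF tri(1), of u3] su[OF tri(2), of u1] su[OF tri(2), of u3]
      su[OF tri(3), of u1] su[OF tri(3), of u2] st[OF tri(1), of t2] st[OF tri(1), of t3]
      st[OF tri(2), of t1] st[OF tri(2), of t3] st[OF tri(3), of t1] st[OF tri(3), of t2] ut u t by metis+
  have nsym: "\<not> E b a" if "\<not> E a b" for a b using that sym by blast
  note adj = e n ns ut e[THEN sym] ut[THEN sym] n[THEN nsym] ns[THEN nsym]
  have inV: "u1 \<in> V" "u2 \<in> V" "u3 \<in> V" "t1 \<in> V" "t2 \<in> V" "t3 \<in> V" "s1 \<in> V" "s2 \<in> V" "s3 \<in> V"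
    using e edge_in by blast+
  \<comment> \<open>A union of two of the seven sets fails for one of two reasons: it contains one
    of the three triangles, or an edge \<open>u_i\<close>-\<open>t_j\<close> together with the
    \<open>s_k\<close> of the third index, which is adjacent to neither end.\<close>
  have tr: "\<not> cb S" if "tri u t s" "u \<in> S" "t \<in> S" "s \<in> S" for u t s S
    using not_cbI[of u S t s] triD[OF that(1)] that(2-4) by blast
  note tr' = tr[OF tri(1)] tr[OF tri(2)] tr[OF tri(3)]
  have far: "\<not> cb S" if "E u t" "\<not> E s u" "\<not> E s t" "u \<in> S" "t \<in> S" "s \<in> S" for u t s S
    using not_cbI[of u S t s] that by blast
  note far' = far[of u3 t2 s1] far[of u2 t3 s1] far[of u3 t1 s2] far[of u1 t3 s2] far[of u2 t1 s3] far[of u1 t2 s3]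
  let ?U = "{u1, u2, u3} \<union> {t1, t2, t3}"
  let ?A1 = "{u1} \<union> {s1, t2, t3}" and ?A2 = "{u2} \<union> {s2, t1, t3}" and ?A3 = "{u3} \<union> {s3, t1, t2}"
  let ?B1 = "{t1} \<union> {s1, u2, u3}" and ?B2 = "{t2} \<union> {s2, u1, u3}" and ?B3 = "{t3} \<union> {s3, u1, u2}"
  have cbs: "cb ?U" "cb ?A1" "cb ?A2" "cb ?A3" "cb ?B1" "cb ?B2" "cb ?B3"
    by (rule cb_bipartition; simp add: bipartition_def inV irrefl adj)+
  have "length [?U, ?A1, ?A2, ?A3, ?B1, ?B2, ?B3] \<le> card (bicliques V E)"
  proof (rule length_fooling_list)
    show "cb C" if "C \<in> set [?U, ?A1, ?A2, ?A3, ?B1, ?B2, ?B3]" for C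
    proof -
      have "\<forall>C\<in>set [?U, ?A1, ?A2, ?A3, ?B1, ?B2, ?B3]. cb C"
        by (simp only: list.set ball_simps cbs simp_thms)
      then show ?thesis using that by blast
    qed
    show "sorted_wrt (\<lambda>C D. \<not> cb (C \<union> D)) [?U, ?A1, ?A2, ?A3, ?B1, ?B2, ?B3]"
      by (simp add: tr' far' adj)
  qed
  then show False using few_bicliques by simp
qed

text \<open>For three distinct triples the \<open>u_i\<close> are distinct, the \<open>t_i\<close>
  are distinct, and every \<open>t_j\<close> lies in \<open>Y\<close> and so is adjacent to every
  \<open>u_i\<close>.\<close>

lemma fibre_le_2:
  assumes "(u1, t1, s1) \<in> P" "(u2, t2, s2) \<in> P" "(u3, t3, s3) \<in> P"
    and Y: "N u1 - {s1} = Y" "N u2 - {s2} = Y" "N u3 - {s3} = Y"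
  shows "(u1, t1, s1) = (u2, t2, s2) \<or> (u2, t2, s2) = (u3, t3, s3) \<or> (u1, t1, s1) = (u3, t3, s3)"
proof (rule ccontr)
  assume neq: "\<not> ?thesis"
  have tri: "tri u1 t1 s1" "tri u2 t2 s2" "tri u3 t3 s3" using assms(1-3) by (auto simp: P_def)
  have "(u, t, s) = (u', t', s')"
    if "tri u t s" "tri u' t' s'" "N u - {s} = Y" "N u' - {s'} = Y" "u = u'" for u t s u' t' s'
    using node_eq_unique[of u t s t' s'] that by simp
  note inj = this[OF tri(1,2) Y(1,2)] this[OF tri(1,3) Y(1,3)] this[OF tri(2,3) Y(2,3)]
  have u: "u1 \<noteq> u2" "u1 \<noteq> u3" "u2 \<noteq> u3" using neq inj by blast+
  have t: "t1 \<noteq> t2" "t1 \<noteq> t3" "t2 \<noteq> t3"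
    using shared_distinct[OF tri(1,2,3) Y(1,2,3)] shared_distinct[OF tri(1,3,2) Y(1,3,2)]
      shared_distinct[OF tri(2,3,1) Y(2,3,1)] u by blast+
  have "t \<in> Y" if "tri u t s" "N u - {s} = Y" for u t s
    using triD(1,5)[OF that(1)] irrefl[of t] that(2) by auto
  then have "t1 \<in> Y" "t2 \<in> Y" "t3 \<in> Y" using tri Y by simp_all
  then have "t2 \<in> N u1 - {s1}" "t3 \<in> N u1 - {s1}" "t1 \<in> N u2 - {s2}" "t3 \<in> N u2 - {s2}"
    "t1 \<in> N u3 - {s3}" "t2 \<in> N u3 - {s3}" unfolding Y by simp_all
  then have "E u1 t2" "E u1 t3" "E u2 t1" "E u2 t3" "E u3 t1" "E u3 t2" by simp_all
  then show False by (rule seven_bicliques[OF tri u t])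
qed

text \<open>If \<open>N u - {s}\<close> is the neighbourhood of a vertex in no triangle, it is replaced by \<open>N t - {u}\<close>,
  which no other triangle vertex produces; this keeps the fibres of size at most two.\<close>

definition node :: "'a \<times> 'a \<times> 'a \<Rightarrow> 'a set" where
  "node = (\<lambda>(u, t, s). if N u - {s} \<in> N ` I then N t - {u} else N u - {s})"

lemma node_fibre: "card {x \<in> P. node x = Y} \<le> 2"
proof (rule card_le_2I)
  have free_or_loop: "N u - {s} = Y \<and> N u - {s} \<notin> N ` I \<or> N t - {u} = Y \<and> N u - {s} \<in> N ` I"
    if "(u, t, s) \<in> {x \<in> P. node x = Y}" for u t s
    using that by (auto simp: node_def split: if_splits)
  \<comment> \<open>A value taken in the replacement branch arises only from the triple itself and
    possibly, in the other branch, from its rotation. If no replacement occurs,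
    \<open>fibre_le_2\<close> applies.\<close>
  have loop: "y = (u, t, s) \<or> y = (t, s, u)"
    if x: "(u, t, s) \<in> P" "N t - {u} = Y" "N u - {s} \<in> N ` I" and y: "y \<in> {x \<in> P. node x = Y}" for u t s y
  proof -
    obtain u' t' s' where y': "y = (u', t', s')" by (cases y)
    obtain v where v: "v \<in> I" "N u - {s} = N v" using x(3) by blast
    have tri: "tri u t s" "tri u' t' s'" using x(1) y y' by (auto simp: P_def)
    show ?thesis
      using free_or_loop[OF y[unfolded y']]
    proof
      assume "N u' - {s'} = Y \<and> N u' - {s'} \<notin> N ` I"
      then show ?thesis using loop_next_unshared[OF tri(1) v tri(2)] x(2) y' by simp
    next
      assume "N t' - {u'} = Y \<and> N u' - {s'} \<in> N ` I"
      then show ?thesis using loop_next_unshared[OF tri(1) v tri_rotate[OF tri(2)]] x(2) y' by simp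
    qed
  qed
  fix a b c assume abc: "a \<in> {x \<in> P. node x = Y}" "b \<in> {x \<in> P. node x = Y}" "c \<in> {x \<in> P. node x = Y}"
  obtain u1 t1 s1 u2 t2 s2 u3 t3 s3 where s: "a = (u1, t1, s1)" "b = (u2, t2, s2)" "c = (u3, t3, s3)"
    by (cases a, cases b, cases c)
  have inP: "(u1, t1, s1) \<in> P" "(u2, t2, s2) \<in> P" "(u3, t3, s3) \<in> P" using abc s by auto
  consider "N u1 - {s1} = Y" "N u2 - {s2} = Y" "N u3 - {s3} = Y"
    | "N t1 - {u1} = Y" "N u1 - {s1} \<in> N ` I" | "N t2 - {u2} = Y" "N u2 - {s2} \<in> N ` I"
    | "N t3 - {u3} = Y" "N u3 - {s3} \<in> N ` I"
    using free_or_loop[OF abc(1)[unfolded s(1)]] free_or_loop[OF abc(2)[unfolded s(2)]]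
      free_or_loop[OF abc(3)[unfolded s(3)]] by argo
  then show "a = b \<or> b = c \<or> a = c"
  proof cases
    case 1
    then show ?thesis using fibre_le_2[OF inP] s by blast
  next
    case 2
    then show ?thesis using loop[OF inP(1) _ _ abc(2)] loop[OF inP(1) _ _ abc(3)] s(1) by metis
  next
    case 3
    then show ?thesis using loop[OF inP(2) _ _ abc(1)] loop[OF inP(2) _ _ abc(3)] s(2) by metis
  next
    case 4
    then show ?thesis using loop[OF inP(3) _ _ abc(1)] loop[OF inP(3) _ _ abc(2)] s(3) by metis
  qed
qed

section \<open>Counting sides against vertices\<close>

lemma side_node:
  assumes "tri u t s"
  shows "side (N u - {s})"
proof (rule sideI)
  have t: "t \<in> N u - {s}" using triD(1,5)[OF assms] irrefl by auto
  then show "N u - {s} \<noteq> {}" by blast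
  show "\<not> E y y'" if "y \<in> N u - {s}" "y' \<in> N u - {s}" for y y'
  proof
    assume "E y y'"
    then have "{y, y'} = {s, t}"
      using vertex_triangle[of u s t y y'] triD[OF assms] that by auto
    then show False using that by (auto simp: doubleton_eq_iff)
  qed
  show "\<exists>y\<in>N u - {s}. E z y" if "z \<in> N u" "z \<notin> N u - {s}" for z
    using that t triD(5)[OF assms] by blast
qed blast

lemma side_loop:
  assumes "v \<in> I"
  shows "side (N v)"
proof (rule sideI)
  show "N v \<noteq> {}" using no_isolated[of v] assms by (auto simp: I_def)
qed (use no_triangle_at_I[OF assms] in auto)

lemma card_V_le: "card V \<le> 2 * card (bicliques V E)"
proof -
  have "\<exists>t s. tri u t s" if "u \<in> V - I" for u using that by (auto simp: I_def)
  then obtain g h where g: "\<And>u. u \<in> V - I \<Longrightarrow> tri u (g u) (h u)" by metis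
  \<comment> \<open>The two orders of the triangle at \<open>u\<close> give two triples, which
    compensates for the fibres of \<open>node\<close> having size up to two.\<close>
  let ?f = "\<lambda>u. (u, g u, h u)" and ?k = "\<lambda>u. (u, h u, g u)"
  have fin: "finite (V - I)" "finite I" using finite_V by (auto simp: I_def)
  have "g u \<noteq> h u" if "u \<in> V - I" for u using triD(2)[OF g[OF that]] irrefl by metis
  then have "?f ` (V - I) \<inter> ?k ` (V - I) = {}" by fastforce
  then have two: "card (?f ` (V - I) \<union> ?k ` (V - I)) = card (V - I) + card (V - I)"
    using fin by (subst card_Un_disjoint) (auto simp: card_image inj_on_def)
  have "?f ` (V - I) \<subseteq> P" using g by (auto simp: P_def)
  moreover have "?k ` (V - I) \<subseteq> P" using tri_swap[OF g] by (auto simp: P_def)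
  ultimately have "?f ` (V - I) \<union> ?k ` (V - I) \<subseteq> P" by (rule Un_least)
  from card_mono[OF finite_P this] have "2 * card (V - I) \<le> card P" unfolding two by simp
  also have "card P \<le> 2 * card (node ` P)" by (rule card_le_fibres[OF finite_P node_fibre])
  finally have T: "card (V - I) \<le> card (node ` P)" by simp
  have free: "node x \<notin> N ` I" if "x \<in> P" for x
  proof -
    obtain u t s where x: "x = (u, t, s)" "tri u t s" using \<open>x \<in> P\<close> by (auto simp: P_def)
    show ?thesis
    proof (cases "N u - {s} \<in> N ` I")
      case True
      then obtain v where "v \<in> I" "N u - {s} = N v" by blast
      then have "N t - {u} \<notin> N ` I" using loop_next_free[OF x(2)] by blast
      then show ?thesis using True by (simp add: node_def x(1))
    qed (simp add: node_def x(1))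
  qed
  have "card (N ` I) = card I" by (rule card_image, rule inj_on_subset[OF inj_N]) (auto simp: I_def)
  moreover have "card (N ` I \<union> node ` P) = card (N ` I) + card (node ` P)"
  proof (rule card_Un_disjoint)
    show "N ` I \<inter> node ` P = {}" using free by blast
  qed (use fin(2) finite_P in simp_all)
  moreover have "side (node x)" if "x \<in> P" for x
  proof -
    obtain u t s where x: "x = (u, t, s)" "tri u t s" using \<open>x \<in> P\<close> by (auto simp: P_def)
    then show ?thesis using side_node[OF x(2)] side_node[OF tri_rotate[OF x(2)]] by (simp add: node_def)
  qed
  then have "N ` I \<union> node ` P \<subseteq> {Y. side Y}" using side_loop by blast
  then have "card (N ` I \<union> node ` P) \<le> card {Y. side Y}" by (rule card_mono[OF card_sides(2)])
  moreover have "card V = card I + card (V - I)"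
    using fin by (subst card_Un_disjoint[symmetric]) (auto simp: I_def intro: arg_cong[of _ _ card])
  ultimately show ?thesis using T card_sides(1) by linarith
qed

end

section \<open>A checker for small induced subgraphs\<close>

fun sub :: "bool list \<Rightarrow> bool list \<Rightarrow> bool" where
  "sub (True # as) (True # bs) = sub as bs"
| "sub (True # as) (False # bs) = False"
| "sub (False # as) (True # bs) = sub as bs"
| "sub (False # as) (False # bs) = sub as bs"
| "sub [] bs = True"
| "sub as [] = True"

fun apart :: "bool list \<Rightarrow> bool list \<Rightarrow> bool" where
  "apart (True # as) (True # bs) = False"
| "apart (True # as) (False # bs) = apart as bs"
| "apart (False # as) (True # bs) = apart as bs"
| "apart (False # as) (False # bs) = apart as bs"
| "apart [] bs = True"
| "apart as [] = True"

fun inhab :: "bool list \<Rightarrow> bool" where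
  "inhab [] = False"
| "inhab (True # as) = True"
| "inhab (False # as) = inhab as"

fun join :: "bool list \<Rightarrow> bool list \<Rightarrow> bool list" where
  "join (True # as) (True # bs) = True # join as bs"
| "join (True # as) (False # bs) = True # join as bs"
| "join (False # as) (True # bs) = True # join as bs"
| "join (False # as) (False # bs) = False # join as bs"
| "join [] bs = []"
| "join as [] = []"

text \<open>The checker branches with \<open>if\<close> instead of using connectives, because the simplifier evaluates
  both arguments of a conjunction but only the selected branch of a conditional.\<close>

fun every :: "('b \<Rightarrow> bool) \<Rightarrow> 'b list \<Rightarrow> bool" where
  "every Q [] = True"
| "every Q (x # xs) = (if Q x then every Q xs else False)"

fun any :: "('b \<Rightarrow> bool) \<Rightarrow> 'b list \<Rightarrow> bool" where
  "any Q [] = False"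
| "any Q (x # xs) = (if Q x then True else any Q xs)"

lemma every_iff: "every Q xs \<longleftrightarrow> (\<forall>x\<in>set xs. Q x)"
  by (induction xs) auto

lemma any_iff: "any Q xs \<longleftrightarrow> (\<exists>x\<in>set xs. Q x)"
  by (induction xs) auto

lemma sub_Cons: "sub (a # as) (b # bs) \<longleftrightarrow> (a \<longrightarrow> b) \<and> sub as bs"
  by (cases a; cases b) auto

lemma sub_map: "sub (map f vs) (map g vs) \<longleftrightarrow> (\<forall>u\<in>set vs. f u \<longrightarrow> g u)"
  by (induction vs) (auto simp: sub_Cons)

lemma sub_refl: "sub as as"
  by (induction as) (auto simp: sub_Cons)

text \<open>The lengths matter: \<open>sub\<close> accepts as soon as one of the lists ends.\<close>

lemma sub_trans:
  "length as = length bs \<Longrightarrow> length bs = length cs \<Longrightarrow> sub as bs \<Longrightarrow> sub bs cs \<Longrightarrow> sub as cs"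
  by (induction as bs cs rule: list_induct3) (auto simp: sub_Cons)

lemma apart_map: "apart (map f vs) (map g vs) \<longleftrightarrow> (\<forall>u\<in>set vs. \<not> (f u \<and> g u))"
proof (induction vs)
  case (Cons v vs)
  then show ?case by (cases "f v"; cases "g v") auto
qed simp

lemma inhab_map: "inhab (map f vs) \<longleftrightarrow> (\<exists>u\<in>set vs. f u)"
proof (induction vs)
  case (Cons v vs)
  then show ?case by (cases "f v") auto
qed simp

lemma join_map: "join (map f vs) (map g vs) = map (\<lambda>u. f u \<or> g u) vs"
proof (induction vs)
  case (Cons v vs)
  then show ?case by (cases "f v"; cases "g v") auto
qed simp

section \<open>Enumeration of the bicliques of a pattern\<close>

fun fits :: "bool list \<Rightarrow> bool list \<times> bool list \<Rightarrow> bool" where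
  "fits t (X, Y) = (if apart t X then sub Y t else False)"

text \<open>A graph on a list of vertices is represented by its rows, each listing the adjacencies of a
  vertex to the later ones.\<close>

primrec pattern :: "('a \<Rightarrow> 'a \<Rightarrow> bool) \<Rightarrow> 'a list \<Rightarrow> bool list list" where
  "pattern E [] = []"
| "pattern E (v # vs) = map (E v) vs # pattern E vs"

text \<open>Only one orientation of each bipartition is generated: the last vertex used is on the left.\<close>

fun add_vertex :: "bool list \<Rightarrow> bool list \<times> bool list \<Rightarrow> (bool list \<times> bool list) list" where
  "add_vertex t (X, Y) = (False # X, False # Y) #
     (if fits t (X, Y) then [(True # X, False # Y)] else []) @
     (if inhab X then if fits t (Y, X) then [(False # X, True # Y)] else [] else [])"

fun pairs :: "bool list list \<Rightarrow> (bool list \<times> bool list) list" where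
  "pairs [] = [([], [])]"
| "pairs (t # p) = concat (map (add_vertex t) (pairs p))"

definition bips :: "bool list list \<Rightarrow> (bool list \<times> bool list) list" where
  "bips p = filter (\<lambda>(X, Y). if inhab X then inhab Y else False) (pairs p)"

fun maximals :: "bool list list \<Rightarrow> bool list list \<Rightarrow> bool list list" where
  "maximals [] Ms = Ms"
| "maximals (Z # Zs) Ms = (if any (sub Z) Ms then maximals Zs Ms
     else maximals Zs (Z # filter (\<lambda>M. \<not> sub M Z) Ms))"

definition bics :: "bool list list \<Rightarrow> bool list list" where
  "bics p = maximals (map (\<lambda>(X, Y). join X Y) (bips p)) []"

section \<open>Traces of a vertex on a pattern\<close>

definition both_ways :: "(bool list \<times> bool list) list \<Rightarrow> (bool list \<times> bool list) list" where
  "both_ways Cs = Cs @ map prod.swap Cs"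

fun within :: "bool list \<times> bool list \<Rightarrow> (bool list \<times> bool list) list \<Rightarrow> bool" where
  "within (A, B) [] = False"
| "within (A, B) ((X, Y) # Cs) =
     (if sub B Y then if sub A X then True else within (A, B) Cs else within (A, B) Cs)"

fun covered :: "bool list \<Rightarrow> (bool list \<times> bool list) list \<Rightarrow> (bool list \<times> bool list) list \<Rightarrow> bool" where
  "covered t [] Cs = True"
| "covered t (C # Ps) Cs = (if fits t C then if within C Cs then covered t Ps Cs else False else covered t Ps Cs)"

text \<open>A necessary condition on the trace of \<open>v\<close> when the pattern has as many
  bicliques as the graph: a bipartition in \<open>Ps\<close> whose left side \<open>v\<close> can
  join must lie within one in \<open>Cs\<close> whose left side \<open>v\<close> can also join. Both
  orientations are supplied, as \<open>v\<close> may join either side.\<close>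

definition admissible :: "(bool list \<times> bool list) list \<Rightarrow> (bool list \<times> bool list) list \<Rightarrow> bool list \<Rightarrow> bool" where
  "admissible Ps Cs t = (if inhab t then covered t Ps (filter (fits t) Cs) else False)"

definition masks :: "nat \<Rightarrow> bool list list" where
  "masks n = List.n_lists n [True, False]"

text \<open>With \<open>Ms\<close> the maximal vectors, the inner filter keeps exactly the
  bipartitions of bicliques. The bound is one less than the assumed number of vertices.\<close>

definition few_traces :: "bool list list \<Rightarrow> bool list list \<Rightarrow> bool" where
  "few_traces p Ms \<longleftrightarrow> length (filter
     (admissible (filter (\<lambda>C. inhab (snd C)) (both_ways (pairs p)))
       (both_ways (filter (\<lambda>(X, Y). any (\<lambda>M. sub M (join X Y)) Ms) (bips p))))
     (masks (length p))) \<le> 12"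

text \<open>A pattern is refuted if it has seven bicliques, or if it has six and admits at most twelve
  traces: in a graph with at most six bicliques it then determines all vertices.\<close>

definition refuted_by :: "bool list list \<Rightarrow> bool list list \<Rightarrow> bool" where
  "refuted_by p Ms = (if length Ms < 6 then False else if length Ms = 6 then few_traces p Ms else True)"

definition refuted :: "bool list list \<Rightarrow> bool" where
  "refuted p = refuted_by p (bics p)"

section \<open>Forbidden patterns\<close>

fun rows :: "bool list list \<Rightarrow> bool list list" where
  "rows [] = []"
| "rows (t # p) = (False # t) # map2 Cons t (rows p)"

text \<open>In a forbidden pattern the traces determine the vertices because the adjacency of two outer
  vertices is forced by their traces: every other choice is refuted. When one of the traces is the
  row of a pattern vertex, the forced adjacency must be the one of that vertex (\<open>consistent\<close>).\<close>

definition clash :: "bool list list \<Rightarrow> bool list \<Rightarrow> bool list \<Rightarrow> bool" where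
  "clash p S R = (if refuted ((True # R) # S # p) then True else refuted ((False # R) # S # p))"

text \<open>For equal traces the only adjacency left open is nonadjacency, in agreement with a
  vertex compared to itself.\<close>

fun clashes :: "bool list list \<Rightarrow> bool list list \<Rightarrow> bool" where
  "clashes p [] = True"
| "clashes p (S # Ss) = (if refuted ((True # S) # S # p) then
     if every (clash p S) Ss then clashes p Ss else False else False)"

fun consistent :: "bool list list \<Rightarrow> bool list list \<Rightarrow> bool list \<Rightarrow> bool" where
  "consistent p rs R = every (\<lambda>(S, b). refuted (((\<not> b) # R) # S # p)) (zip rs R)"

text \<open>Every vertex has a trace among the rows \<open>rs\<close> or the new traces
  \<open>us\<close>, so injectivity of traces leaves at most 12 vertices.\<close>

definition rigid :: "bool list list \<Rightarrow> bool list list \<Rightarrow> bool list list \<Rightarrow> bool list list \<Rightarrow> bool" where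
  "rigid p rs ts us = (if length rs + length us \<le> 12 then
     if distinct rs then if every (consistent p rs) ts then clashes p us else False else False else False)"

definition rigid_types :: "bool list list \<Rightarrow> bool list list \<Rightarrow> bool list list \<Rightarrow> bool" where
  "rigid_types p rs ts = rigid p rs ts (filter (\<lambda>S. S \<notin> set rs) ts)"

definition forbidden :: "bool list list \<Rightarrow> bool" where
  "forbidden p = rigid_types p (rows p) (filter (\<lambda>R. \<not> refuted (R # p)) (masks (length p)))"

lemma forbidden_K4: "forbidden [[True, True, True], [True, True], [True], []]"
  by code_simp

lemma forbidden_butterfly:
  "forbidden [[True, True, True, True], [True, False, False], [False, False], [True], []]"
  by code_simp

text \<open>The dominating vertex comes first, then the path in order.\<close>

lemma forbidden_gem:
  "forbidden [[True, True, True, True], [True, False, False], [True, False], [True], []]"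
  by code_simp

text \<open>A diamond preceded by a pendant vertex, which hangs on a vertex of degree two of the
  diamond.\<close>

lemma forbidden_kite:
  "forbidden [[True, False, False, False], [True, True, False], [True, True], [True], []]"
  by code_simp


section \<open>Soundness of the checker\<close>

definition marks :: "'a set \<Rightarrow> 'a list \<Rightarrow> bool list" where
  "marks A vs = map (\<lambda>u. u \<in> A) vs"

lemma marks_Cons: "marks A (v # vs) = (v \<in> A) # marks A vs"
  by (simp add: marks_def)

lemma marks_insert: "v \<notin> set vs \<Longrightarrow> marks (insert v A) vs = marks A vs"
  by (auto simp: marks_def)

lemma sub_marks: "sub (marks A vs) (marks B vs) \<longleftrightarrow> A \<inter> set vs \<subseteq> B"
  by (auto simp: marks_def sub_map)

lemma inhab_marks: "inhab (marks A vs) \<longleftrightarrow> A \<inter> set vs \<noteq> {}"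
  by (auto simp: marks_def inhab_map)

lemma join_marks: "join (marks A vs) (marks B vs) = marks (A \<union> B) vs"
  by (simp add: marks_def join_map)

lemma fits_marks:
  "fits (map f vs) (marks A vs, marks B vs) \<longleftrightarrow> (\<forall>u\<in>set vs. (u \<in> A \<longrightarrow> \<not> f u) \<and> (u \<in> B \<longrightarrow> f u))"
  by (auto simp: marks_def apart_map sub_map)

lemma marks_eq_iff: "marks A vs = marks B vs \<longleftrightarrow> A \<inter> set vs = B \<inter> set vs"
  by (auto simp: marks_def)

section \<open>Correctness of the enumeration\<close>

lemma pairs_inhab: "(X, Y) \<in> set (pairs p) \<Longrightarrow> inhab Y \<Longrightarrow> inhab X"
proof (induction p arbitrary: X Y)
  case (Cons t p)
  then obtain X0 Y0 where "(X0, Y0) \<in> set (pairs p)" "(X, Y) \<in> set (add_vertex t (X0, Y0))" by auto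
  then show ?case using Cons.IH Cons.prems(2) by (auto split: if_splits)
qed simp

lemma within_iff: "within (A, B) Cs \<longleftrightarrow> (\<exists>(X, Y)\<in>set Cs. sub A X \<and> sub B Y)"
  by (induction Cs) (auto split: if_splits)

lemma covered_iff: "covered t Ps Cs \<longleftrightarrow> (\<forall>C\<in>set Ps. fits t C \<longrightarrow> within C Cs)"
  by (induction Ps) auto

definition incomparable :: "bool list \<Rightarrow> bool list \<Rightarrow> bool" where
  "incomparable Z M \<longleftrightarrow> \<not> sub Z M \<and> \<not> sub M Z"

text \<open>The accumulator stays an antichain: a vector below a kept one is dropped, any other one
  displaces the kept vectors below it.\<close>

lemma maximals:
  assumes "\<And>Z. Z \<in> set Zs \<union> set Ms \<Longrightarrow> length Z = n" "sorted_wrt incomparable Ms"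
  shows "sorted_wrt incomparable (maximals Zs Ms)"
    and "set (maximals Zs Ms) \<subseteq> set Zs \<union> set Ms"
    and "\<And>Z. Z \<in> set Zs \<union> set Ms \<Longrightarrow> \<exists>M\<in>set (maximals Zs Ms). sub Z M"
proof -
  have "sorted_wrt incomparable (maximals Zs Ms) \<and> set (maximals Zs Ms) \<subseteq> set Zs \<union> set Ms \<and>
    (\<forall>Z\<in>set Zs \<union> set Ms. \<exists>M\<in>set (maximals Zs Ms). sub Z M)"
    using assms
  proof (induction Zs arbitrary: Ms)
    case Nil
    then show ?case using sub_refl by auto
  next
    case (Cons Z Zs)
    let ?Ns = "if any (sub Z) Ms then Ms else Z # filter (\<lambda>M. \<not> sub M Z) Ms"
    have max: "maximals (Z # Zs) Ms = maximals Zs ?Ns" by simp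
    have "sorted_wrt incomparable ?Ns"
    proof (cases "any (sub Z) Ms")
      case False
      then have "\<forall>M\<in>set (filter (\<lambda>M. \<not> sub M Z) Ms). incomparable Z M"
        by (auto simp: any_iff incomparable_def)
      then show ?thesis using False sorted_wrt_filter[OF Cons.prems(2)] by simp
    qed (use Cons.prems(2) in simp)
    moreover have "length M = n" if "M \<in> set Zs \<union> set ?Ns" for M
      using that Cons.prems(1) by (auto split: if_splits)
    ultimately have IH: "sorted_wrt incomparable (maximals Zs ?Ns)" "set (maximals Zs ?Ns) \<subseteq> set Zs \<union> set ?Ns"
      "\<forall>M\<in>set Zs \<union> set ?Ns. \<exists>M'\<in>set (maximals Zs ?Ns). sub M M'"
      using Cons.IH[of ?Ns] by blast+
    have above: "\<exists>M'\<in>set Zs \<union> set ?Ns. sub M M'" if "M \<in> set (Z # Zs) \<union> set Ms" for M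
      using that sub_refl by (auto simp: any_iff)
    have "\<exists>M'\<in>set (maximals Zs ?Ns). sub M M'" if M: "M \<in> set (Z # Zs) \<union> set Ms" for M
    proof -
      obtain M1 where M1: "M1 \<in> set Zs \<union> set ?Ns" "sub M M1" using above[OF M] by blast
      then obtain M2 where M2: "M2 \<in> set (maximals Zs ?Ns)" "sub M1 M2" using IH(3) by blast
      have "set Zs \<union> set ?Ns \<subseteq> set (Z # Zs) \<union> set Ms" by (auto split: if_splits)
      then have "length M = n" "length M1 = n" "length M2 = n"
        using Cons.prems(1) M M1(1) M2(1) IH(2) by blast+
      then show ?thesis using sub_trans[of M M1 M2] M1(2) M2 by auto
    qed
    moreover have "set (maximals Zs ?Ns) \<subseteq> set (Z # Zs) \<union> set Ms"
      using IH(2) by (auto split: if_splits)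
    ultimately show ?case unfolding max using IH(1) by blast
  qed
  then show "sorted_wrt incomparable (maximals Zs Ms)"
    and "set (maximals Zs Ms) \<subseteq> set Zs \<union> set Ms"
    and "\<And>Z. Z \<in> set Zs \<union> set Ms \<Longrightarrow> \<exists>M\<in>set (maximals Zs Ms). sub Z M" by blast+
qed

lemma sorted_incomparable:
  assumes "sorted_wrt incomparable Ms"
  shows "distinct Ms" and "M \<in> set Ms \<Longrightarrow> M' \<in> set Ms \<Longrightarrow> sub M M' \<Longrightarrow> M = M'"
proof -
  show "distinct Ms"
    using assms by (induction Ms) (auto simp: incomparable_def sub_refl)
  show "M = M'" if "M \<in> set Ms" "M' \<in> set Ms" "sub M M'"
    using assms that by (induction Ms) (auto simp: incomparable_def)
qed

context finite_graph
begin

lemma bipartition_insert: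
  "bipartition (insert v A) B \<longleftrightarrow> bipartition A B \<and> (\<forall>a\<in>A. \<not> E v a) \<and> (\<forall>b\<in>B. E v b)"
proof -
  have "(\<forall>a\<in>A. \<not> E a v) \<longleftrightarrow> (\<forall>a\<in>A. \<not> E v a)" using adj_commute by simp
  then show ?thesis unfolding bipartition_def using irrefl by (simp add: ball_conj_distrib) argo
qed

lemma pairs_sound:
  assumes "distinct vs" "(X, Y) \<in> set (pairs (pattern E vs))"
  shows "\<exists>A B. A \<subseteq> set vs \<and> B \<subseteq> set vs \<and> X = marks A vs \<and> Y = marks B vs \<and> bipartition A B"
  using assms
proof (induction vs arbitrary: X Y)
  case Nil
  then show ?case by (auto simp: marks_def bipartition_def)
next
  case (Cons v vs)
  then obtain X0 Y0 where XY0: "(X0, Y0) \<in> set (pairs (pattern E vs))"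
    "(X, Y) \<in> set (add_vertex (map (E v) vs) (X0, Y0))" by auto
  obtain A B where AB: "A \<subseteq> set vs" "B \<subseteq> set vs" "X0 = marks A vs" "Y0 = marks B vs" "bipartition A B"
    using Cons.IH[OF _ XY0(1)] Cons.prems(1) by auto
  have v: "v \<notin> set vs" "v \<notin> A" "v \<notin> B" using Cons.prems(1) AB(1,2) by auto
  from XY0(2) consider "(X, Y) = (False # X0, False # Y0)"
    | "fits (map (E v) vs) (X0, Y0)" "(X, Y) = (True # X0, False # Y0)"
    | "fits (map (E v) vs) (Y0, X0)" "(X, Y) = (False # X0, True # Y0)"
    by (auto split: if_splits)
  then show ?case
  proof cases
    case 1
    then show ?thesis using AB v by (intro exI[of _ A] exI[of _ B]) (auto simp: marks_Cons)
  next
    case 2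
    then have "bipartition (insert v A) B"
      using AB unfolding AB(3,4) fits_marks bipartition_insert by blast
    then show ?thesis using 2(2) AB v
      by (intro exI[of _ "insert v A"] exI[of _ B]) (auto simp: marks_Cons marks_insert)
  next
    case 3
    then have "bipartition (insert v B) A"
      using AB bipartition_commute unfolding AB(3,4) fits_marks bipartition_insert by blast
    then show ?thesis using 3(2) AB v bipartition_commute
      by (intro exI[of _ A] exI[of _ "insert v B"]) (auto simp: marks_Cons marks_insert)
  qed
qed

text \<open>Only one orientation is generated, hence the disjunction.\<close>

lemma pairs_complete:
  "bipartition A B \<Longrightarrow> (marks A vs, marks B vs) \<in> set (pairs (pattern E vs)) \<or>
    (marks B vs, marks A vs) \<in> set (pairs (pattern E vs))"
proof (induction vs arbitrary: A B)
  case Nil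
  then show ?case by (simp add: marks_def)
next
  case (Cons v vs)
  let ?t = "map (E v) vs"
  have step: "(marks A (v # vs), marks B (v # vs)) \<in> set (pairs (pattern E (v # vs))) \<or>
      (marks B (v # vs), marks A (v # vs)) \<in> set (pairs (pattern E (v # vs)))"
    if AB: "bipartition A B" and v: "v \<in> A" for A B
  proof -
    have fits: "fits ?t (marks A vs, marks B vs)"
      using AB v unfolding fits_marks bipartition_def by blast
    have "v \<notin> B" using AB v irrefl unfolding bipartition_def by blast
    then have m: "marks A (v # vs) = True # marks A vs" "marks B (v # vs) = False # marks B vs"
      using v by (simp_all add: marks_Cons)
    have first: "(True # marks A vs, False # marks B vs) \<in> set (add_vertex ?t (marks A vs, marks B vs))"
      using fits by simp
    from Cons.IH[OF AB] show ?thesis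
    proof
      assume "(marks A vs, marks B vs) \<in> set (pairs (pattern E vs))"
      then show ?thesis using first unfolding m by (auto simp del: add_vertex.simps)
    next
      assume BA: "(marks B vs, marks A vs) \<in> set (pairs (pattern E vs))"
      show ?thesis
      proof (cases "inhab (marks B vs)")
        case True
        then have "(False # marks B vs, True # marks A vs) \<in> set (add_vertex ?t (marks B vs, marks A vs))"
          using fits by simp
        then show ?thesis using BA unfolding m by (auto simp del: add_vertex.simps)
      next
        \<comment> \<open>With the left side empty, \<open>pairs_inhab\<close> makes both sides
          empty, so the two orientations coincide.\<close>
        case False
        then have "\<not> inhab (marks A vs)" using pairs_inhab[OF BA] by blast
        then have "marks A vs = marks B vs" using False by (simp add: inhab_marks marks_eq_iff)
        then show ?thesis using BA first unfolding m by (auto simp del: add_vertex.simps)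
      qed
    qed
  qed
  consider "v \<in> A" | "v \<in> B" | "v \<notin> A" "v \<notin> B" by blast
  then show ?case
  proof cases
    case 1
    then show ?thesis using step[of A B] Cons.prems by blast
  next
    case 2
    then show ?thesis using step[of B A] Cons.prems bipartition_commute by blast
  next
    case 3
    then have m: "marks A (v # vs) = False # marks A vs" "marks B (v # vs) = False # marks B vs"
      by (simp_all add: marks_Cons)
    have "(False # X, False # Y) \<in> set (add_vertex ?t (X, Y))" for X Y by simp
    then show ?thesis using Cons.IH[OF Cons.prems] unfolding m by (auto simp del: add_vertex.simps)
  qed
qed

lemma bips_complete:
  assumes "bipartition A B" "A \<inter> set vs \<noteq> {}" "B \<inter> set vs \<noteq> {}"
  shows "(marks A vs, marks B vs) \<in> set (bips (pattern E vs)) \<or>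
    (marks B vs, marks A vs) \<in> set (bips (pattern E vs))"
  using pairs_complete[OF assms(1), of vs] assms(2,3) by (auto simp: bips_def inhab_marks)

text \<open>The bicliques of the subgraph induced on \<open>vs\<close>, as sets instead of
  vectors.\<close>

definition found :: "'a list \<Rightarrow> 'a set set" where
  "found vs = {S. S \<subseteq> set vs \<and> marks S vs \<in> set (bics (pattern E vs))}"

context
  fixes vs :: "'a list"
  assumes vs: "distinct vs" "set vs \<subseteq> V"
begin

lemma joins_eq:
  "set (map (\<lambda>(X, Y). join X Y) (bips (pattern E vs))) = (\<lambda>S. marks S vs) ` {S. S \<subseteq> set vs \<and> cb S}"
proof (intro equalityI subsetI)
  fix Z assume "Z \<in> set (map (\<lambda>(X, Y). join X Y) (bips (pattern E vs)))"
  then obtain X Y where XY: "(X, Y) \<in> set (pairs (pattern E vs))" "inhab X" "inhab Y" "Z = join X Y"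
    by (auto simp: bips_def split: if_splits)
  obtain A B where AB: "A \<subseteq> set vs" "B \<subseteq> set vs" "X = marks A vs" "Y = marks B vs" "bipartition A B"
    using pairs_sound[OF vs(1) XY(1)] by (elim exE conjE)
  then have "A \<noteq> {}" "B \<noteq> {}" using XY(2,3) by (auto simp: inhab_marks)
  then have "cb (A \<union> B)" using cb_bipartition[OF AB(5)] AB(1,2) vs(2) by blast
  then show "Z \<in> (\<lambda>S. marks S vs) ` {S. S \<subseteq> set vs \<and> cb S}"
    using AB XY(4) by (intro image_eqI[of _ _ "A \<union> B"]) (simp_all add: join_marks)
next
  fix Z assume "Z \<in> (\<lambda>S. marks S vs) ` {S. S \<subseteq> set vs \<and> cb S}"
  then obtain S where S: "S \<subseteq> set vs" "cb S" "Z = marks S vs" by blast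
  then obtain x y where "x \<in> S" "y \<in> S" "E x y" unfolding cb_iff by blast
  then have ne: "{z\<in>S. \<not> E x z} \<inter> set vs \<noteq> {}" "{z\<in>S. E x z} \<inter> set vs \<noteq> {}"
    using S(1) irrefl by blast+
  have un: "{z\<in>S. \<not> E x z} \<union> {z\<in>S. E x z} = S" "{z\<in>S. E x z} \<union> {z\<in>S. \<not> E x z} = S" by blast+
  from bips_complete[OF cb_split(1)[OF S(2) \<open>x \<in> S\<close>] ne]
  show "Z \<in> set (map (\<lambda>(X, Y). join X Y) (bips (pattern E vs)))"
    unfolding S(3) set_map by (elim disjE rev_image_eqI) (simp_all add: join_marks un)
qed

lemma bics:
  shows "sorted_wrt incomparable (bics (pattern E vs))"
    and "set (bics (pattern E vs)) \<subseteq> (\<lambda>S. marks S vs) ` {S. S \<subseteq> set vs \<and> cb S}"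
    and "S \<subseteq> set vs \<Longrightarrow> cb S \<Longrightarrow> \<exists>M\<in>set (bics (pattern E vs)). sub (marks S vs) M"
proof -
  let ?Zs = "map (\<lambda>(X, Y). join X Y) (bips (pattern E vs))"
  have len: "length Z = length vs" if "Z \<in> set ?Zs \<union> set []" for Z
    using that unfolding Un_iff joins_eq by (auto simp: marks_def)
  have srt: "sorted_wrt incomparable []" by simp
  show "sorted_wrt incomparable (bics (pattern E vs))"
    unfolding bics_def by (rule maximals(1)[of ?Zs "[]"], erule len, rule srt)
  have "set (bics (pattern E vs)) \<subseteq> set ?Zs \<union> set []"
    unfolding bics_def by (rule maximals(2)[of ?Zs "[]"], erule len, rule srt)
  then show "set (bics (pattern E vs)) \<subseteq> (\<lambda>S. marks S vs) ` {S. S \<subseteq> set vs \<and> cb S}"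
    unfolding joins_eq by simp
  have above: "\<exists>M\<in>set (bics (pattern E vs)). sub Z M" if "Z \<in> set ?Zs \<union> set []" for Z
    unfolding bics_def by (rule maximals(3)[of ?Zs "[]"], erule len, rule srt, rule that)
  show "\<exists>M\<in>set (bics (pattern E vs)). sub (marks S vs) M" if "S \<subseteq> set vs" "cb S"
    by (rule above) (use that in \<open>unfold Un_iff joins_eq, blast\<close>)
qed

lemma found_cb: "S \<in> found vs \<Longrightarrow> S \<subseteq> set vs \<and> cb S"
proof -
  assume S: "S \<in> found vs"
  then obtain S' where "marks S vs = marks S' vs" "S' \<subseteq> set vs" "cb S'"
    using bics(2) unfolding found_def by blast
  moreover from this have "S = S'" using S unfolding found_def marks_eq_iff by blast
  ultimately show ?thesis by simp
qed

lemma found_maximal: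
  assumes "S \<in> found vs" "D \<subseteq> set vs" "cb D" "S \<subseteq> D"
  shows "D = S"
proof -
  obtain M where M: "M \<in> set (bics (pattern E vs))" "sub (marks D vs) M" using bics(3) assms(2,3) by blast
  then obtain T where T: "M = marks T vs" "T \<subseteq> set vs" using bics(2) by blast
  then have DT: "D \<subseteq> T" using M(2) assms(2) by (auto simp: sub_marks)
  then have "sub (marks S vs) M" using T assms(4) by (auto simp: sub_marks)
  then have "marks S vs = M"
    using sorted_incomparable(2)[OF bics(1)] M(1) assms(1) unfolding found_def by blast
  then have "S \<inter> set vs = T \<inter> set vs" unfolding T(1) marks_eq_iff .
  then have "S = T" using T(2) assms(1) unfolding found_def by blast
  then show ?thesis using DT assms(4) by blast
qed

text \<open>A complete bipartite union of two members stays inside \<open>vs\<close>, so by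
  maximality it equals both.\<close>

lemma fooling_found: "fooling (found vs)"
  unfolding fooling_def
proof (intro conjI ballI impI notI)
  show "cb S" if "S \<in> found vs" for S using found_cb that by blast
  fix C D assume CD: "C \<in> found vs" "D \<in> found vs" "C \<noteq> D" "cb (C \<union> D)"
  then have "C \<union> D \<subseteq> set vs" using found_cb by blast
  then have "C \<union> D = C" "C \<union> D = D" using found_maximal CD by blast+
  then show False using CD(3) by blast
qed

lemma finite_found: "finite (found vs)"
  by (rule finite_subset[of _ "Pow (set vs)"]) (auto simp: found_def)

lemma card_found: "card (found vs) = length (bics (pattern E vs))"
proof -
  have "inj_on (\<lambda>S. marks S vs) (found vs)"
    by (rule inj_onI) (auto simp: found_def marks_eq_iff)
  moreover have "(\<lambda>S. marks S vs) ` found vs = set (bics (pattern E vs))"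
    using bics(2) unfolding found_def by blast
  ultimately have "card (found vs) = card (set (bics (pattern E vs)))" using card_image by metis
  then show ?thesis using sorted_incomparable(1)[OF bics(1)] by (simp add: distinct_card)
qed

end

end

section \<open>Traces in a counterexample\<close>

locale counterexample = twin_free_graph +
  assumes few_bicliques: "card (bicliques V E) \<le> 6"
    and many_vertices: "13 \<le> card V"
begin

text \<open>Since \<open>v\<close> is adjacent to exactly one end of every edge of \<open>S\<close>,
  it splits \<open>S\<close> into two nonempty sides.\<close>

lemma split_found:
  assumes "cb T" "v \<in> T" "S \<subseteq> T" "cb S"
  shows "bipartition {z\<in>S. \<not> E v z} {z\<in>S. E v z}" "{z\<in>S. \<not> E v z} \<noteq> {}" "{z\<in>S. E v z} \<noteq> {}"
proof -
  show "bipartition {z\<in>S. \<not> E v z} {z\<in>S. E v z}"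
    by (rule bipartition_mono[OF cb_split(1)[OF assms(1,2)]]) (use assms(3) in blast)+
  obtain x y where xy: "x \<in> S" "y \<in> S" "E x y" using assms(4) unfolding cb_iff by blast
  then have "E v x \<longleftrightarrow> \<not> E v y" using assms(1-3) unfolding cb_iff by blast
  then show "{z\<in>S. \<not> E v z} \<noteq> {}" "{z\<in>S. E v z} \<noteq> {}" using xy by blast+
qed

lemma cb_edge: "E u w \<Longrightarrow> cb ({u} \<union> {w})"
  by (rule cb_bipartition) (use irrefl edge_in in \<open>auto simp: bipartition_def\<close>)

context
  fixes vs :: "'a list"
  assumes vs: "distinct vs" "set vs \<subseteq> V"
    and six: "length (bics (pattern E vs)) = 6"
begin

lemma card_bicliques_le: "card (bicliques V E) \<le> card (found vs)"
  using few_bicliques card_found[OF vs] six by simp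

lemma found_hits:
  assumes "cb D"
  obtains S where "S \<in> found vs" "cb S" "S \<subseteq> set vs" "cb (S \<union> D)"
  using fooling_hits[OF fooling_found[OF vs] finite_found[OF vs] card_bicliques_le assms]
    found_cb[OF vs] by metis

lemma neighbour_in_pattern:
  assumes "v \<in> V"
  shows "\<exists>u\<in>set vs. E v u"
proof -
  obtain w where "E v w" using no_isolated assms by blast
  then obtain S where S: "cb S" "S \<subseteq> set vs" "cb (S \<union> ({v} \<union> {w}))"
    using found_hits[OF cb_edge] by metis
  have "{z\<in>S. E v z} \<noteq> {}" by (rule split_found(3)[OF S(3) _ _ S(1)]) blast+
  then show ?thesis using S(2) by blast
qed

text \<open>The edge \<open>u\<close>-\<open>w\<close> lies in a biclique \<open>B\<close> above
  some pattern biclique \<open>S\<close>. As \<open>v\<close> fits \<open>S\<close> in the same way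
  as \<open>u\<close>, and \<open>S\<close> lies in only one biclique, \<open>v\<close> belongs to
  \<open>B\<close> on the side of \<open>u\<close>, and so it is adjacent to
  \<open>w\<close>.\<close>

lemma trace_determines:
  assumes "v \<in> V" and same: "\<And>x. x \<in> set vs \<Longrightarrow> E u x \<longleftrightarrow> E v x" and "E u w"
  shows "E v w"
proof (rule ccontr)
  assume nvw: "\<not> E v w"
  obtain S where S: "S \<in> found vs" "cb S" "S \<subseteq> set vs" "cb (S \<union> ({u} \<union> {w}))"
    using found_hits[OF cb_edge[OF assms(3)]] by metis
  let ?X = "{z\<in>S. \<not> E u z}" and ?Y = "{z\<in>S. E u z}"
  have XY: "bipartition ?X ?Y" "?X \<noteq> {}" "?Y \<noteq> {}"
    by (rule split_found[OF S(4) _ _ S(2)]; blast)+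
  have "bipartition (insert v ?X) ?Y"
    unfolding bipartition_insert using XY(1) same S(3) by auto
  then have "cb (insert v ?X \<union> ?Y)"
    by (rule cb_bipartition) (use assms(1) S(3) vs(2) XY(3) in auto)
  then obtain B' where B': "B' \<in> bicliques V E" "insert v ?X \<union> ?Y \<subseteq> B'" by (rule cb_extend)
  obtain B where B: "B \<in> bicliques V E" "S \<union> ({u} \<union> {w}) \<subseteq> B" using cb_extend[OF S(4)] .
  have "S \<subseteq> B'" using B'(2) by blast
  then have "B = B'"
    using fooling_unique_biclique[OF fooling_found[OF vs] finite_found[OF vs] card_bicliques_le S(1) B(1) B'(1)]
      B(2) by blast
  moreover obtain y where y: "y \<in> S" "E u y" using XY(3) by blast
  ultimately have inB: "u \<in> B" "v \<in> B" "w \<in> B" "y \<in> B" using B(2) B'(2) by blast+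
  have "E v y" using same[of y] y S(3) by blast
  have "cb B" using B(1) by (simp add: bicliques_def)
  then have dich: "E z x \<longleftrightarrow> \<not> E z y" if "x \<in> B" "y \<in> B" "z \<in> B" "E x y" for x y z
    using that unfolding cb_iff by blast
  have "E w y" using dich[of v y w] inB \<open>E v y\<close> nvw sym by blast
  then show False using dich[of u w y] inB assms(3) y(2) sym by blast
qed

lemma inj_trace: "inj_on (\<lambda>v. map (E v) vs) V"
proof (rule inj_onI)
  fix u v assume uv: "u \<in> V" "v \<in> V" "map (E u) vs = map (E v) vs"
  then have "E u x \<longleftrightarrow> E v x" if "x \<in> set vs" for x using that by simp
  then have "E u w \<longleftrightarrow> E v w" for w
    using trace_determines[OF uv(1), of v w] trace_determines[OF uv(2), of u w] by blast
  then have "N u = N v" by auto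
  then show "u = v" using inj_onD[OF inj_N] uv(1,2) by blast
qed

lemma admissible_trace:
  assumes "v \<in> V"
  shows "admissible (filter (\<lambda>C. inhab (snd C)) (both_ways (pairs (pattern E vs))))
    (both_ways (filter (\<lambda>(X, Y). any (\<lambda>M. sub M (join X Y)) (bics (pattern E vs))) (bips (pattern E vs))))
    (map (E v) vs)" (is "admissible ?Ps ?Cs ?t")
proof -
  have "within C (filter (fits ?t) ?Cs)" if C: "C \<in> set ?Ps" "fits ?t C" for C
  proof -
    obtain X Y where "C = (X, Y)" by (rule prod.exhaust)
    then have XY: "C = (X, Y)" "inhab Y"
      "(X, Y) \<in> set (pairs (pattern E vs)) \<or> (Y, X) \<in> set (pairs (pattern E vs))"
      using C(1) by (auto simp: both_ways_def)
    have "\<exists>A B. A \<subseteq> set vs \<and> B \<subseteq> set vs \<and> X = marks A vs \<and> Y = marks B vs \<and> bipartition A B"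
      using XY(3) pairs_sound[OF vs(1), of X Y] pairs_sound[OF vs(1), of Y X] bipartition_commute by metis
    then obtain A B where AB: "A \<subseteq> set vs" "B \<subseteq> set vs" "X = marks A vs" "Y = marks B vs" "bipartition A B"
      by (elim exE conjE)
    have fit: "\<forall>u\<in>set vs. (u \<in> A \<longrightarrow> \<not> E v u) \<and> (u \<in> B \<longrightarrow> E v u)"
      using C(2) unfolding XY(1) AB(3,4) fits_marks .
    have "B \<noteq> {}" using XY(2) unfolding AB(4) inhab_marks by blast
    moreover have "bipartition (insert v A) B" using AB fit unfolding bipartition_insert by blast
    \<comment> \<open>This set is compatible with some pattern biclique \<open>S\<close>. By
      maximality of \<open>S\<close> within the pattern, \<open>A\<close> and \<open>B\<close> are
      contained in \<open>S\<close>, and the split of \<open>S\<close> by \<open>v\<close> is the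
      required larger bipartition.\<close>
    ultimately have "cb (insert v A \<union> B)"
      using cb_bipartition AB(1,2) vs(2) assms by (metis insert_not_empty insert_subset order_trans)
    then obtain S where S: "S \<in> found vs" "cb S" "S \<subseteq> set vs" "cb (S \<union> (insert v A \<union> B))"
      using found_hits by metis
    have "cb (S \<union> A \<union> B)" by (rule cb_mono[OF S(2) _ _ S(4)]) blast+
    then have "S \<union> A \<union> B = S" using found_maximal[OF vs S(1), of "S \<union> A \<union> B"] S(3) AB(1,2) by blast
    then have sub: "A \<subseteq> S" "B \<subseteq> S" by blast+
    let ?X = "{z\<in>S. \<not> E v z}" and ?Y = "{z\<in>S. E v z}"
    have split: "bipartition ?X ?Y" "?X \<noteq> {}" "?Y \<noteq> {}"
      by (rule split_found[OF S(4) _ _ S(2)]; blast)+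
    have un: "?X \<union> ?Y = S" "?Y \<union> ?X = S" by blast+
    have meet: "?X \<inter> set vs \<noteq> {}" "?Y \<inter> set vs \<noteq> {}" using split(2,3) S(3) by blast+
    have "any (\<lambda>M. sub M (marks S vs)) (bics (pattern E vs))"
      unfolding any_iff using S(1) sub_refl unfolding found_def by blast
    then have "(marks ?X vs, marks ?Y vs) \<in> set ?Cs"
      using bips_complete[OF split(1) meet] unfolding both_ways_def set_append Un_iff set_map set_filter
      by (elim disjE) (auto simp: join_marks un intro!: image_eqI[of _ _ "(marks ?Y vs, marks ?X vs)"])
    moreover have "fits ?t (marks ?X vs, marks ?Y vs)" unfolding fits_marks by blast
    moreover have "sub (marks A vs) (marks ?X vs)" "sub (marks B vs) (marks ?Y vs)"
      unfolding sub_marks using sub fit by blast+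
    ultimately show ?thesis unfolding XY(1) AB(3,4) within_iff set_filter by blast
  qed
  then show ?thesis
    using neighbour_in_pattern[OF assms] by (simp add: admissible_def covered_iff inhab_map)
qed

end

lemma length_pattern: "length (pattern E vs) = length vs"
  by (induction vs) auto

lemma trace_in_masks: "map f vs \<in> set (masks (length vs))"
  by (auto simp: masks_def set_n_lists)

lemma card_V_le_traces:
  assumes "inj_on (\<lambda>v. map (E v) vs) V" "\<And>v. v \<in> V \<Longrightarrow> map (E v) vs \<in> set ts"
  shows "13 \<le> length ts"
proof -
  have "card V = card ((\<lambda>v. map (E v) vs) ` V)" using card_image[OF assms(1)] by simp
  also have "\<dots> \<le> card (set ts)" by (rule card_mono) (use assms(2) in auto)
  also have "\<dots> \<le> length ts" by (rule card_length)
  finally show ?thesis using many_vertices by simp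
qed

lemma not_refuted:
  assumes vs: "distinct vs" "set vs \<subseteq> V"
  shows "\<not> refuted (pattern E vs)"
proof
  assume ref: "refuted (pattern E vs)"
  \<comment> \<open>The bicliques of the pattern form a fooling family, so seven of them are
    impossible.\<close>
  have "length (bics (pattern E vs)) \<le> 6"
    using card_fooling[OF fooling_found[OF vs]] card_found[OF vs] few_bicliques by simp
  then have six: "length (bics (pattern E vs)) = 6"
    and few: "few_traces (pattern E vs) (bics (pattern E vs))"
    using ref by (auto simp: refuted_def refuted_by_def split: if_splits)
  let ?adm = "admissible (filter (\<lambda>C. inhab (snd C)) (both_ways (pairs (pattern E vs))))
    (both_ways (filter (\<lambda>(X, Y). any (\<lambda>M. sub M (join X Y)) (bics (pattern E vs))) (bips (pattern E vs))))"
  have "map (E v) vs \<in> set (filter ?adm (masks (length vs)))" if "v \<in> V" for v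
    unfolding set_filter using admissible_trace[OF vs six that] trace_in_masks by blast
  then have "13 \<le> length (filter ?adm (masks (length vs)))"
    by (rule card_V_le_traces[OF inj_trace[OF vs six]])
  moreover have "length (filter ?adm (masks (length vs))) \<le> 12"
    using few unfolding few_traces_def length_pattern .
  ultimately have "(13::nat) \<le> 12" by (rule le_trans)
  then show False by simp
qed

section \<open>Forbidden patterns are not induced subgraphs\<close>

lemma map2_Cons: "map2 Cons (map f vs) (map g vs) = map (\<lambda>u. f u # g u) vs"
  by (induction vs) auto

text \<open>The rows of the full adjacency matrix are the traces of the pattern vertices on the
  pattern itself.\<close>

lemma rows_pattern: "rows (pattern E vs) = map (\<lambda>u. map (E u) vs) vs"
proof (induction vs)
  case (Cons v vs)
  have "map (\<lambda>u. E v u # map (E u) vs) vs = map (\<lambda>u. E u v # map (E u) vs) vs"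
    by (rule map_cong) (use adj_commute in blast)+
  moreover have "rows (pattern E (v # vs)) = (False # map (E v) vs) # map (\<lambda>u. E v u # map (E u) vs) vs"
    by (simp only: pattern.simps rows.simps Cons.IH map2_Cons)
  ultimately show ?case using irrefl[of v] by simp
qed simp

lemma clashesD:
  "clashes p Ss \<Longrightarrow> S \<in> set Ss \<Longrightarrow> refuted ((True # S) # S # p)"
  "clashes p Ss \<Longrightarrow> S \<in> set Ss \<Longrightarrow> R \<in> set Ss \<Longrightarrow> S \<noteq> R \<Longrightarrow>
    \<exists>b. refuted ((b # R) # S # p) \<or> refuted ((b # S) # R # p)"
  by (induction Ss) (auto simp: every_iff clash_def split: if_splits)

text \<open>Traces are shown to be injective, which contradicts the bound on their number. If
  \<open>w\<close> separated two vertices \<open>u\<close> and \<open>v\<close> of equal trace, both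
  adjacencies would occur for one pair of traces, although at most one is permitted.\<close>

lemma not_forbidden:
  assumes vs: "distinct vs" "set vs \<subseteq> V"
  shows "\<not> forbidden (pattern E vs)"
proof
  assume forb: "forbidden (pattern E vs)"
  let ?p = "pattern E vs" and ?tr = "\<lambda>v. map (E v) vs"
  define ts where "ts = filter (\<lambda>R. \<not> refuted (R # ?p)) (masks (length vs))"
  define us where "us = filter (\<lambda>S. S \<notin> set (rows ?p)) ts"
  have short: "length (rows ?p) + length us \<le> 12" and dist: "distinct (rows ?p)"
    and cons: "\<And>R. R \<in> set ts \<Longrightarrow> consistent ?p (rows ?p) R" and cl: "clashes ?p us"
    using forb unfolding forbidden_def rigid_types_def rigid_def length_pattern ts_def us_def
    by (auto simp: every_iff split: if_splits)
  have ts: "?tr v \<in> set ts" if "v \<in> V" "v \<notin> set vs" for v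
    using not_refuted[of "v # vs"] that vs trace_in_masks by (simp add: ts_def)
  have two: "\<not> refuted ((E x y # ?tr x) # ?tr y # ?p)"
    if "x \<in> V" "y \<in> V" "x \<notin> set vs" "y \<notin> set vs" "x \<noteq> y" for x y
    using not_refuted[of "x # y # vs"] that vs by simp
  \<comment> \<open>A vertex sharing the trace of a pattern vertex \<open>h\<close> looks like
    \<open>h\<close> to every other outer vertex, by \<open>consistent\<close>.\<close>
  have twin: "E x y \<longleftrightarrow> E x h"
    if xy: "x \<in> V" "y \<in> V" "x \<notin> set vs" "y \<notin> set vs" "x \<noteq> y" and h: "h \<in> set vs" "?tr y = ?tr h" for x y h
  proof (rule ccontr)
    assume "E x y \<noteq> E x h"
    then have "E x y = (\<not> E x h)" by blast
    moreover have "(?tr h, E x h) \<in> set (zip (rows ?p) (?tr x))"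
      using h(1) unfolding rows_pattern zip_map_map by (auto simp: zip_same_conv_map)
    then have "refuted (((\<not> E x h) # ?tr x) # ?tr h # ?p)"
      using cons[OF ts[OF xy(1,3)]] by (auto simp: every_iff)
    ultimately show False using two[OF xy] h(2) by simp
  qed
  have inj_vs: "inj_on ?tr (set vs)"
    using dist unfolding rows_pattern distinct_map by blast
  have "inj_on ?tr V"
  proof (rule inj_onI, rule ccontr)
    fix u v assume uv: "u \<in> V" "v \<in> V" "?tr u = ?tr v" "u \<noteq> v"
    obtain w where w: "E u w \<noteq> E v w" using distinguish[OF uv(1,2,4)] .
    then have wV: "w \<in> V" using edge_in by blast
    have wvs: "w \<notin> set vs" using uv(3) w by auto
    show False
    proof (cases "\<exists>h\<in>set vs. ?tr h = ?tr u")
      case True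
      then obtain h where h: "h \<in> set vs" "?tr h = ?tr u" by blast
      have "E w y \<longleftrightarrow> E w h" if y: "y \<in> V" "?tr y = ?tr u" for y
      proof (cases "y \<in> set vs")
        case True
        then show ?thesis using inj_onD[OF inj_vs, of y h] h y by simp
      next
        case out: False
        show ?thesis
        proof (cases "w = y")
          case True
          then have "E w h \<longleftrightarrow> E h h" using h y(2) by (metis map_eq_conv)
          then show ?thesis using True irrefl by blast
        next
          case False
          then show ?thesis using twin[OF wV y(1) wvs out _ h(1)] y(2) h(2) by simp
        qed
      qed
      then have "E w u \<longleftrightarrow> E w v" using uv by simp
      then show False using w adj_commute by metis
    next
      case no: False
      then have out: "u \<notin> set vs" "v \<notin> set vs" using uv(3) by auto
      show False
      proof (cases "\<exists>h\<in>set vs. ?tr h = ?tr w")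
        case True
        then obtain h where h: "h \<in> set vs" "?tr h = ?tr w" by blast
        then have "w \<noteq> u" "w \<noteq> v" using no uv(3) by auto
        then have "E u w \<longleftrightarrow> E u h" "E v w \<longleftrightarrow> E v h"
          using twin[OF uv(1) wV out(1) wvs _ h(1)] twin[OF uv(2) wV out(2) wvs _ h(1)] h(2) by auto
        moreover have "E u h \<longleftrightarrow> E v h" using uv(3) h(1) by auto
        ultimately show False using w by blast
      next
        case False
        have us: "?tr u \<in> set us" "?tr w \<in> set us"
          using ts[OF uv(1) out(1)] ts[OF wV wvs] no False by (auto simp: us_def rows_pattern)
        \<comment> \<open>Which of \<open>u\<close> and \<open>v\<close> is adjacent to
          \<open>w\<close> is irrelevant: \<open>x\<close> realises the adjacency and
          \<open>z\<close> the nonadjacency.\<close>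
        obtain x where x: "x \<in> {u, v}" "E x w" using w by auto
        obtain z where z: "z \<in> {u, v}" "\<not> E z w" using w by auto
        have xz: "x \<in> V" "x \<notin> set vs" "?tr x = ?tr u" "z \<in> V" "z \<notin> set vs" "?tr z = ?tr u"
          using x(1) z(1) uv out by auto
        show False
        proof (cases "?tr u = ?tr w")
          case True
          have "x \<noteq> w" using x(2) irrefl by blast
          then have "\<not> refuted ((True # ?tr u) # ?tr u # ?p)"
            using two[OF xz(1) wV xz(2) wvs] x(2) unfolding xz(3) True[symmetric] by simp
          then show False using clashesD(1)[OF cl us(1)] by blast
        next
          case False
          \<comment> \<open>Both orders of the two outer vertices are needed, because
            \<open>clashesD(2)\<close> leaves open which one is refuted.\<close>
          have either: "\<not> refuted ((E y w # ?tr w) # ?tr u # ?p) \<and> \<not> refuted ((E y w # ?tr u) # ?tr w # ?p)"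
            if y: "y \<in> V" "y \<notin> set vs" "?tr y = ?tr u" for y
          proof -
            have "y \<noteq> w" using y(3) False by auto
            then show ?thesis
              using two[OF wV y(1) wvs y(2)] two[OF y(1) wV y(2) wvs] adj_commute[of w y]
              unfolding y(3) by simp
          qed
          have "\<not> refuted ((b # ?tr w) # ?tr u # ?p) \<and> \<not> refuted ((b # ?tr u) # ?tr w # ?p)" for b
            using either[OF xz(1-3)] either[OF xz(4-6)] x(2) z(2) by (cases b) simp_all
          then show False using clashesD(2)[OF cl us False] by blast
        qed
      qed
    qed
  qed
  moreover have "?tr v \<in> set (rows ?p @ us)" if "v \<in> V" for v
    using ts[OF that] by (cases "v \<in> set vs") (auto simp: us_def rows_pattern)
  ultimately have "13 \<le> length (rows ?p @ us)" by (rule card_V_le_traces)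
  then show False using short by simp
qed

end

section \<open>Excluding triangles that meet\<close>

lemma contradiction_of_counterexample:
  assumes "counterexample V E"
  shows False
proof -
  interpret counterexample V E by (rule assms)
  have no_K4: False
    if "E a b" "E a c" "E a d" "E b c" "E b d" "E c d" for a b c d
  proof -
    have "distinct [a, b, c, d]" "set [a, b, c, d] \<subseteq> V" using that irrefl edge_in by auto
    then show False using not_forbidden[of "[a, b, c, d]"] forbidden_K4 that by simp
  qed
  have no_diamond: False
    if e: "E p q" "E a p" "E a q" "E d p" "E d q" and "a \<noteq> d" for a d p q
  proof -
    have nad: "\<not> E a d" using no_K4[of a d p q] e by blast
    \<comment> \<open>Twin-freeness separates the nonadjacent vertices \<open>a\<close> and
      \<open>d\<close>. After renaming, \<open>x\<close> is adjacent to \<open>a\<close> only;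
      according to whether it sees both, one or none of \<open>p\<close> and \<open>q\<close>, there
      is a \<open>K4\<close>, a gem or a kite.\<close>
    obtain x where "E a x \<noteq> E d x"
      using distinguish[OF edge_in(1)[OF e(2)] edge_in(1)[OF e(4)] \<open>a \<noteq> d\<close>] .
    then obtain a d x where x: "E p q" "E a p" "E a q" "E d p" "E d q" "a \<noteq> d" "\<not> E a d" "E x a" "\<not> E x d"
      using e \<open>a \<noteq> d\<close> nad adj_commute by metis
    have "\<not> E d a" "\<not> E d x" using x(7,9) sym by blast+
    note s = this x(1-5,8)[THEN sym]
    have gem: False if "E p q" "E a p" "E a q" "E d p" "E d q" "E x p" "\<not> E x q" for p q
    proof -
      have d: "distinct [p, x, a, q, d]" "set [p, x, a, q, d] \<subseteq> V"
        using that x s irrefl edge_in by auto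
      then have "pattern E [p, x, a, q, d] = [[True, True, True, True], [True, False, False], [True, False], [True], []]"
        using that that(1-6)[THEN sym] x s by simp
      then show False using not_forbidden[OF d] forbidden_gem by simp
    qed
    consider "E x p" "E x q" | "E x p" "\<not> E x q" | "E x q" "\<not> E x p" | "\<not> E x p" "\<not> E x q" by blast
    then show False
    proof cases
      case 1
      then show ?thesis using no_K4[of x a p q] x by blast
    next
      case 2
      then show ?thesis using gem[of p q] x by blast
    next
      case 3
      then show ?thesis using gem[of q p] x sym by blast
    next
      case 4
      have d: "distinct [x, a, p, q, d]" "set [x, a, p, q, d] \<subseteq> V"
        using 4 x s irrefl edge_in by auto
      then have "pattern E [x, a, p, q, d] = [[True, False, False, False], [True, True, False], [True, True], [True], []]"
        using 4 x s by simp
      then show False using not_forbidden[OF d] forbidden_kite by simp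
    qed
  qed
  have "disjoint_triangles V E"
  proof
    show "p = q" if "E x y" "E x p" "E y p" "E x q" "E y q" for x y p q
      using no_diamond[of x y p q] that sym by blast
    show "{s', t'} = {s, t}"
      if e: "E u s" "E u t" "E s t" "E u s'" "E u t'" "E s' t'" for u s t s' t'
    proof (rule ccontr)
      assume neq: "{s', t'} \<noteq> {s, t}"
      have one: "r = r'" if "E u a" "E a r" "E u r" "E a r'" "E u r'" for a r r'
        using no_diamond[of u a r r'] that sym by blast
      \<comment> \<open>Without diamonds, two different triangles at \<open>u\<close> share nothing
        else and have no edges between them, so they induce a butterfly.\<close>
      have diff: "s \<noteq> s'" "s \<noteq> t'" "t \<noteq> s'" "t \<noteq> t'"
        using neq one[of s t t'] one[of s t s'] one[of t s t'] one[of t s s'] e sym by blast+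
      then have non: "\<not> E s s'" "\<not> E s t'" "\<not> E t s'" "\<not> E t t'"
        using one[of s t s'] one[of s t t'] one[of t s s'] one[of t s t'] e sym by blast+
      have d: "distinct [u, s, t, s', t']" "set [u, s, t, s', t'] \<subseteq> V"
        using e diff irrefl edge_in by auto
      then have "pattern E [u, s, t, s', t'] = [[True, True, True, True], [True, False, False], [False, False], [True], []]"
        using e non by simp
      then show False using not_forbidden[OF d] forbidden_butterfly by simp
    qed
    show "card (bicliques V E) \<le> 6" by (rule few_bicliques)
  qed
  then interpret disjoint_triangles V E .
  show False using card_V_le few_bicliques many_vertices by simp
qed

theorem theorem3:
  fixes V :: "'a set" and E :: "'a \<Rightarrow> 'a \<Rightarrow> bool"
  assumes "simple_graph V E"
    and "connected_graph V E"
    and "false_twin_free V E"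
    and "card V \<ge> 13"
  shows "card (bicliques V E) \<ge> 7"
proof (rule ccontr)
  assume few: "\<not> card (bicliques V E) \<ge> 7"
  \<comment> \<open>Connectedness enters here: a path to another vertex leaves \<open>v\<close>
    along an edge.\<close>
  have "\<exists>w. E v w" if v: "v \<in> V" for v
  proof -
    have "V \<noteq> {v}" using assms(4) by auto
    then obtain u where u: "u \<in> V" "u \<noteq> v" using v by auto
    have "E\<^sup>*\<^sup>* v u" using assms(2) v u(1) by (simp add: connected_graph_def)
    then show ?thesis using u(2) by (auto elim: converse_rtranclpE)
  qed
  then have "counterexample V E"
    by unfold_locales (use assms few in simp_all)
  then show False by (rule contradiction_of_counterexample)
qed

end
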